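(* Let $(\hat\nu_k,\hat\nu_{k^+})_{k\ge1}$ be stochastic sequences of measures in $\mathcal M_+(\mathcal X)$, adapted to filtrations $(\mathfrak F_k)_k,(\mathfrak F_k^+)_k$ as in the context, satisfying the assumptions $(\hat{\mathcal H}_D)$, $(\hat{\mathcal H}^+_{\varepsilon,a})$ with $a\ge\frac{d}{2(2+d)}$, $(\hat{\mathcal H}^{\mathrm{smooth},1}_\varepsilon)$, $(\hat{\mathcal H}^{\mathrm{smooth},2}_\varepsilon)$ and $(\hat{\mathcal H}^\infty_{\mathrm{TV}})$ listed in the context, with, for a final horizon $K\ge2$, $$\alpha\le\frac{1}{\mathbf E_\infty}\sqrt{8\log 8},\qquad \beta\le\frac{1}{\alpha^{d/4}\sqrt K},\qquad \varepsilon_k=\frac1{\sqrt K},\qquad m_k=m=K .$$ Let $\nu^\star$ be a minimizer of $J$ over $\mathcal M_+(\mathcal X)$ and $\hat\rho_K:=\min_{1\le k\le K}\{J(\hat\nu_k)-J(\nu^\star)\}$. The total number of stochastic oracle calls over $K$ iterations is $N=K\times m=K^2$, and $$\mathbb E[\hat\rho_K]\le C\,\alpha^{-1/2}\left(\frac{\log N}{\sqrt N}\right)^{\frac{1}{2(2+d)}}$$ for a constant $C>0$ not depending on $K$. In particular $\mathbb E[\hat\rho_K]=\mathcal O\left(N^{-\frac{1}{4(2+d)}}(\log N)^{\frac{1}{2(2+d)}}\right)$.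
   Context: Setting. $\mathcal X\subset\mathbb R^d$ is compact, convex and equal to the closure of its interior. $\mathcal M(\mathcal X)$ is the space of finite signed measures on $\mathcal X$ with total variation norm $\|\cdot\|_{\mathrm{TV}}$, and $\mathcal M_+(\mathcal X)$ the nonnegative ones. $\mathbb H$ is a separable Hilbert space, $\Phi:\mathcal M(\mathcal X)\to\mathbb H$ is bounded, linear and weak-* continuous, so that $\Phi\nu=\int_{\mathcal X}\varphi_t\,d\nu(t)$ with $\varphi_t:=\Phi\delta_t$; the kernel is $K(s,t)=\langle\varphi_s,\varphi_t\rangle_{\mathbb H}$. Given $y\in\mathbb H$ and $\kappa>0$, $J(\nu)=\frac12\|y-\Phi\nu\|_{\mathbb H}^2+\kappa\|\nu\|_{\mathrm{TV}}$ on $\mathcal M_+(\mathcal X)$, and $J'_\nu(t)=\langle\varphi_t,\Phi\nu-y\rangle_{\mathbb H}+\kappa$. For $\nu\in\mathcal M_+(\mathcal X)$, $\|f\|_\nu^2:=\int_{\mathcal X}|f|^2d\nu$. Assumption on the problem: there are $c_{\mathcal P},C_{\mathcal P}>0$ such that $\|y\|_{\mathbb H}\le C_{\mathcal P}$; $K$ is twice continuously differentiable with $\max\{\|K\|_\infty,\|\nabla_sK\|_\infty,\|\nabla_s^2K\|_\infty\}\le C_{\mathcal P}$; $K(s,t)\ge c_{\mathcal P}$ and $K(t,t)=1$ for all $s,t\in\mathcal X$. Stochastic gradients: there is a random variable $Z$ with unbiased estimators $\widehat{J'_\nu}(t,Z)=J'_\nu(t)+\xi_\nu(t,Z)$ and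 $\widehat{D_\nu}(t,Z)=\nabla J'_\nu(t)+\zeta_\nu(t,Z)$, $\mathbb E_Z[\xi_\nu(t,Z)]=0$, $\mathbb E_Z[\zeta_\nu(t,Z)]=0$; $\mathbf E_\infty>0$ is a constant with $|\xi_\nu(t,Z)|\vee\|\zeta_\nu(t,Z)\|\le\mathbf E_\infty$ almost surely for all $t\in\mathcal X$; moreover $\widehat{J'_\nu}(t,Z)\ge\mathbf G\|\nu\|_{\mathrm{TV}}-\mathbf H+\kappa$ a.s. for constants $\mathbf G,\mathbf H>0$, and $t\mapsto\widehat{J'_\nu}(t,Z)$ is a.s. Lipschitz with a uniform constant. At iteration $k$ a mini-batch of $m_k$ i.i.d. copies of $Z$ is averaged; an oracle call is one such sample. Filtrations: increasing $\sigma$-algebras with $\mathfrak F_{k-1}\subset\mathfrak F_{k-1}^+\subset\mathfrak F_k\subset\mathfrak F_k^+$, $\hat\nu_k$ is $\mathfrak F_k$-measurable and $\hat\nu_{k^+}$ is $\mathfrak F_k^+$-measurable. Assumptions on the sequences (parameters: $\alpha,\beta>0$; exploration schedule $\varepsilon_k>0$; mini-batch sizes $m_k\ge1$; $\lambda$ is Lebesgue measure; $C,c>0$ are generic constants that may change from line to line and are independent of $k$ and $d$): $(\hat{\mathcal H}^\infty_{\mathrm{TV}})$: there is a constant $C_{\mathrm{TV}}$ with $\|\hat\nu_k\|_{\mathrm{TV}}\le C_{\mathrm{TV}}$ a.s. for all $k$. $(\hat{\mathcal H}_D)$: for any $k\ge1$, $\mathbb E[J(\hat\nu_{k^+})\mid\mathfrak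 F_k]-J(\hat\nu_k)\le-\frac\alpha2\|J'_{\hat\nu_k}\|^2_{\hat\nu_k}+C\left(\frac{\alpha^2}{m_k}+\beta^2+\frac{\beta}{m_k}\right)$. $(\hat{\mathcal H}^+_{\varepsilon,a})$, for a given $a>0$: for any $k\ge0$ and Borel $\mathcal B\subseteq\mathcal X$, $\mathbb E[\hat\nu_{k+1}(\mathcal B)\mid\mathfrak F_k^+]\ge c\,\varepsilon_k\,\lambda(\mathcal B\cap\{J'_{\hat\nu_{k^+}}<0\})-C\varepsilon_km_k^{-a}$. $(\hat{\mathcal H}^{\mathrm{smooth},1}_\varepsilon)$: for any $k\ge1$, $\mathbb E[J(\hat\nu_{k+1})-J(\hat\nu_{k^+})\mid\mathfrak F_k^+]\le C\left(\varepsilon_k^2+\varepsilon_k\sqrt{\frac{\log m_k}{m_k}}\right)$. $(\hat{\mathcal H}^{\mathrm{smooth},2}_\varepsilon)$: for any $k\ge1$, $\|J'_{\hat\nu_{k+1}}-J'_{\hat\nu_{k^+}}\|_\infty\le C\varepsilon_k$ a.s. *)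

theory Defs
  imports "HOL-Probability.Probability" "HOL-Library.Landau_Symbols"
begin

section \<open>Finite signed and nonnegative measures on a compact set\<close>

abbreviation borel_on :: "'a::topological_space set \<Rightarrow> 'a measure" where
  "borel_on X \<equiv> restrict_space borel X"

text \<open>A finite signed measure is a real-valued countably additive set function on the Borel
  sets of \<open>X\<close>, with the value 0 outside its domain. This is also the convention of
  \<^const>\<open>measure\<close>, so a nonnegative finite measure \<open>\<nu>\<close> on \<open>X\<close> corresponds to the
  element \<open>measure \<nu>\<close> of \<open>signed_measures X\<close>.\<close>

definition signed_measures :: "'a::topological_space set \<Rightarrow> ('a set \<Rightarrow> real) set" where
  "signed_measures X =
    {\<mu>. (\<forall>A. A \<notin> sets (borel_on X) \<longrightarrow> \<mu> A = 0) \<and>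
        \<mu> {} = 0 \<and>
        (\<forall>A :: nat \<Rightarrow> 'a set. range A \<subseteq> sets (borel_on X) \<longrightarrow> disjoint_family A \<longrightarrow>
           (\<lambda>i. \<mu> (A i)) sums \<mu> (\<Union>i. A i))}"

definition M_plus :: "'a::topological_space set \<Rightarrow> 'a measure set" where
  "M_plus X = {\<nu>. sets \<nu> = sets (borel_on X) \<and> finite_measure \<nu>}"

definition tv_norm :: "'a::topological_space set \<Rightarrow> ('a set \<Rightarrow> real) \<Rightarrow> real" where
  "tv_norm X \<mu> =
    (SUP P \<in> {P. finite P \<and> P \<subseteq> sets (borel_on X) \<and> partition_on X P}. \<Sum>B\<in>P. \<bar>\<mu> B\<bar>)"

text \<open>The positive part of the Jordan decomposition, \<open>\<mu>\<^sup>+ A = sup {\<mu> B | B \<subseteq> A}\<close>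
  (the truncation of negative values by \<^const>\<open>ennreal\<close> is harmless because of \<open>B = {}\<close>).
  The negative part of \<open>\<mu>\<close> is the positive part of \<open>-\<mu>\<close>.\<close>

definition jordan_pos :: "'a::topological_space set \<Rightarrow> ('a set \<Rightarrow> real) \<Rightarrow> 'a measure" where
  "jordan_pos X \<mu> =
    measure_of X (sets (borel_on X))
      (\<lambda>A. SUP B \<in> {B \<in> sets (borel_on X). B \<subseteq> A}. ennreal (\<mu> B))"

definition signed_integral ::
    "'a::topological_space set \<Rightarrow> ('a set \<Rightarrow> real) \<Rightarrow> ('a \<Rightarrow> real) \<Rightarrow> real" where
  "signed_integral X \<mu> f =
    (\<integral>t. f t \<partial>jordan_pos X \<mu>) - (\<integral>t. f t \<partial>jordan_pos X (\<lambda>A. - \<mu> A))"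

text \<open>The coarsest topology on \<open>signed_measures X\<close> for which \<open>\<mu> \<mapsto> \<integral>f d\<mu>\<close> is continuous
  for every continuous \<open>f\<close> on \<open>X\<close>.\<close>

definition weak_star :: "'a::topological_space set \<Rightarrow> ('a set \<Rightarrow> real) topology" where
  "weak_star X =
    pullback_topology (signed_measures X)
      (\<lambda>\<mu>. \<lambda>f \<in> {f. continuous_on X f}. signed_integral X \<mu> f)
      (product_topology (\<lambda>_. euclideanreal) {f. continuous_on X f})"

definition dirac :: "'a::topological_space set \<Rightarrow> 'a \<Rightarrow> 'a set \<Rightarrow> real" where
  "dirac X t = measure (return (borel_on X) t)"

section \<open>The forward operator, the kernel and the objective\<close>

text \<open>Weak-* continuity is understood with respect to the weak topology of the Hilbert space:
  a linear operator which is weak-* to norm continuous has finite rank.\<close>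

definition forward_operator ::
    "'a::topological_space set \<Rightarrow> (('a set \<Rightarrow> real) \<Rightarrow> 'h::real_inner) \<Rightarrow> bool" where
  "forward_operator X \<Phi> \<longleftrightarrow>
    (\<forall>\<mu>\<in>signed_measures X. \<forall>\<nu>\<in>signed_measures X. \<Phi> (\<lambda>A. \<mu> A + \<nu> A) = \<Phi> \<mu> + \<Phi> \<nu>) \<and>
    (\<forall>r. \<forall>\<mu>\<in>signed_measures X. \<Phi> (\<lambda>A. r * \<mu> A) = r *\<^sub>R \<Phi> \<mu>) \<and>
    (\<exists>b. \<forall>\<mu>\<in>signed_measures X. norm (\<Phi> \<mu>) \<le> b * tv_norm X \<mu>) \<and>
    (\<forall>h. continuous_map (weak_star X) euclideanreal (\<lambda>\<mu>. inner h (\<Phi> \<mu>)))"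

definition feature ::
    "'a::topological_space set \<Rightarrow> (('a set \<Rightarrow> real) \<Rightarrow> 'h::real_inner) \<Rightarrow> 'a \<Rightarrow> 'h" where
  "feature X \<Phi> t = \<Phi> (dirac X t)"

definition kern ::
    "'a::topological_space set \<Rightarrow> (('a set \<Rightarrow> real) \<Rightarrow> 'h::real_inner) \<Rightarrow> 'a \<Rightarrow> 'a \<Rightarrow> real" where
  "kern X \<Phi> s t = inner (feature X \<Phi> s) (feature X \<Phi> t)"

definition J :: "'a::topological_space set \<Rightarrow> (('a set \<Rightarrow> real) \<Rightarrow> 'h::real_inner) \<Rightarrow> 'h \<Rightarrow> real \<Rightarrow>
    'a measure \<Rightarrow> real" where
  "J X \<Phi> y \<kappa> \<nu> = 1/2 * (norm (y - \<Phi> (measure \<nu>)))\<^sup>2 + \<kappa> * tv_norm X (measure \<nu>)"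

definition J' :: "'a::topological_space set \<Rightarrow> (('a set \<Rightarrow> real) \<Rightarrow> 'h::real_inner) \<Rightarrow> 'h \<Rightarrow> real \<Rightarrow>
    'a measure \<Rightarrow> 'a \<Rightarrow> real" where
  "J' X \<Phi> y \<kappa> \<nu> t = inner (feature X \<Phi> t) (\<Phi> (measure \<nu>) - y) + \<kappa>"

definition sq_norm_in :: "'a measure \<Rightarrow> ('a \<Rightarrow> real) \<Rightarrow> real" where
  "sq_norm_in \<nu> f = (\<integral>t. \<bar>f t\<bar>\<^sup>2 \<partial>\<nu>)"

text \<open>Derivatives are taken within the set. On a convex set that is the closure of its interior
  they are unique, also at boundary points.\<close>

definition gradient_on ::
    "'a::euclidean_space set \<Rightarrow> ('a \<Rightarrow> real) \<Rightarrow> 'a \<Rightarrow> 'a" where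
  "gradient_on S f x = (\<Sum>b\<in>Basis. frechet_derivative f (at x within S) b *\<^sub>R b)"

definition hessian_on ::
    "'a::euclidean_space set \<Rightarrow> ('a \<Rightarrow> real) \<Rightarrow> 'a \<Rightarrow> 'a \<Rightarrow> 'a" where
  "hessian_on S f x = frechet_derivative (gradient_on S f) (at x within S)"

definition C2_on :: "'b::real_normed_vector set \<Rightarrow> ('b \<Rightarrow> real) \<Rightarrow> bool" where
  "C2_on S f \<longleftrightarrow>
    (\<exists>(D :: 'b \<Rightarrow> 'b \<Rightarrow>\<^sub>L real) (D2 :: 'b \<Rightarrow> 'b \<Rightarrow>\<^sub>L ('b \<Rightarrow>\<^sub>L real)).
      (\<forall>z\<in>S. (f has_derivative blinfun_apply (D z)) (at z within S)) \<and>
      (\<forall>z\<in>S. (D has_derivative blinfun_apply (D2 z)) (at z within S)) \<and>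
      continuous_on S D2)"

definition problem_assumption :: "'a::euclidean_space set \<Rightarrow>
    (('a set \<Rightarrow> real) \<Rightarrow> 'h::real_inner) \<Rightarrow> 'h \<Rightarrow> real \<Rightarrow> real \<Rightarrow> bool" where
  "problem_assumption X \<Phi> y cP CP \<longleftrightarrow>
    0 < cP \<and> 0 < CP \<and> norm y \<le> CP \<and>
    C2_on (X \<times> X) (\<lambda>(s, t). kern X \<Phi> s t) \<and>
    (\<forall>s\<in>X. \<forall>t\<in>X.
       \<bar>kern X \<Phi> s t\<bar> \<le> CP \<and>
       norm (gradient_on X (\<lambda>s. kern X \<Phi> s t) s) \<le> CP \<and>
       onorm (hessian_on X (\<lambda>s. kern X \<Phi> s t) s) \<le> CP \<and>
       cP \<le> kern X \<Phi> s t) \<and>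
    (\<forall>t\<in>X. kern X \<Phi> t t = 1)"

section \<open>Stochastic gradients\<close>

text \<open>\<open>Q\<close> is the law of \<open>Z\<close>; \<open>Jh \<nu> t z\<close> and \<open>Dh \<nu> t z\<close> are the estimators of
  \<open>J'\<^sub>\<nu>(t)\<close> and of its gradient, so that \<open>\<xi>\<^sub>\<nu>(t,z)\<close> and \<open>\<zeta>\<^sub>\<nu>(t,z)\<close> are the differences
  below. The Lipschitz constant is uniform in \<open>z\<close>, not in \<open>\<nu>\<close>, because the Lipschitz constant of
  \<open>J'\<^sub>\<nu>\<close> itself scales with \<open>\<nu>\<close>.\<close>

definition stochastic_gradients :: "'a::euclidean_space set \<Rightarrow>
    (('a set \<Rightarrow> real) \<Rightarrow> 'h::real_inner) \<Rightarrow> 'h \<Rightarrow> real \<Rightarrow>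
    'z measure \<Rightarrow> ('a measure \<Rightarrow> 'a \<Rightarrow> 'z \<Rightarrow> real) \<Rightarrow> ('a measure \<Rightarrow> 'a \<Rightarrow> 'z \<Rightarrow> 'a) \<Rightarrow>
    real \<Rightarrow> real \<Rightarrow> real \<Rightarrow> bool" where
  "stochastic_gradients X \<Phi> y \<kappa> Q Jh Dh Einf G H \<longleftrightarrow>
    prob_space Q \<and> 0 < Einf \<and> 0 < G \<and> 0 < H \<and>
    (\<forall>\<nu>\<in>M_plus X.
      (\<forall>t\<in>X.
        Jh \<nu> t \<in> borel_measurable Q \<and> Dh \<nu> t \<in> borel_measurable Q \<and>
        (\<integral>z. Jh \<nu> t z - J' X \<Phi> y \<kappa> \<nu> t \<partial>Q) = 0 \<and>
        (\<integral>z. Dh \<nu> t z - gradient_on X (J' X \<Phi> y \<kappa> \<nu>) t \<partial>Q) = 0 \<and>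
        (AE z in Q. max \<bar>Jh \<nu> t z - J' X \<Phi> y \<kappa> \<nu> t\<bar>
                        (norm (Dh \<nu> t z - gradient_on X (J' X \<Phi> y \<kappa> \<nu>) t)) \<le> Einf) \<and>
        (AE z in Q. Jh \<nu> t z \<ge> G * tv_norm X (measure \<nu>) - H + \<kappa>)) \<and>
      (\<exists>L. AE z in Q. L-lipschitz_on X (\<lambda>t. Jh \<nu> t z)))"

text \<open>Iteration \<open>k\<close> uses \<open>m k\<close> samples, and one sample is one oracle call.\<close>

definition oracle_calls :: "nat \<Rightarrow> (nat \<Rightarrow> nat) \<Rightarrow> nat" where
  "oracle_calls K m = card (SIGMA k:{1..K}. {1..m k})"

section \<open>The random sequences of measures\<close>

definition interlaced_filtrations ::
    "'w measure \<Rightarrow> (nat \<Rightarrow> 'w measure) \<Rightarrow> (nat \<Rightarrow> 'w measure) \<Rightarrow> bool" where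
  "interlaced_filtrations M F Fp \<longleftrightarrow>
    (\<forall>k. subalgebra M (F k) \<and> subalgebra M (Fp k) \<and>
         sets (F k) \<subseteq> sets (Fp k) \<and> sets (Fp k) \<subseteq> sets (F (Suc k)))"

text \<open>Measurability with respect to the \<open>\<sigma>\<close>-algebra generated by the evaluations
  \<open>\<nu> \<mapsto> \<nu>(B)\<close>.\<close>

definition adapted_measures :: "'a::topological_space set \<Rightarrow>
    'w measure \<Rightarrow> (nat \<Rightarrow> 'w measure) \<Rightarrow> (nat \<Rightarrow> 'w \<Rightarrow> 'a measure) \<Rightarrow> bool" where
  "adapted_measures X M F \<nu> \<longleftrightarrow>
    (\<forall>k. (\<forall>\<omega>\<in>space M. \<nu> k \<omega> \<in> M_plus X) \<and>
         (\<forall>B\<in>sets (borel_on X). (\<lambda>\<omega>. measure (\<nu> k \<omega>) B) \<in> borel_measurable (F k)))"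

definition H_TV :: "'a::topological_space set \<Rightarrow> real \<Rightarrow>
    'w measure \<Rightarrow> (nat \<Rightarrow> 'w \<Rightarrow> 'a measure) \<Rightarrow> bool" where
  "H_TV X CTV M \<nu> \<longleftrightarrow> (\<forall>k. AE \<omega> in M. tv_norm X (measure (\<nu> k \<omega>)) \<le> CTV)"

text \<open>Below, \<open>\<nu>p k\<close> is the measure at time \<open>k\<^sup>+\<close>. The value of \<^const>\<open>real_cond_exp\<close> is only
  meaningful for integrable functions. This holds here without being assumed: \<open>\<nu> k\<close> is bounded
  by \<open>H_TV\<close>, and then \<open>\<nu>p k\<close> with \<open>k \<ge> 1\<close> is bounded by \<open>H_smooth2\<close> below and the
  lower bound on the kernel.\<close>

definition H_D :: "'a::euclidean_space set \<Rightarrow>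
    (('a set \<Rightarrow> real) \<Rightarrow> 'h::real_inner) \<Rightarrow> 'h \<Rightarrow> real \<Rightarrow>
    real \<Rightarrow> real \<Rightarrow> real \<Rightarrow> (nat \<Rightarrow> nat) \<Rightarrow>
    'w measure \<Rightarrow> (nat \<Rightarrow> 'w measure) \<Rightarrow>
    (nat \<Rightarrow> 'w \<Rightarrow> 'a measure) \<Rightarrow> (nat \<Rightarrow> 'w \<Rightarrow> 'a measure) \<Rightarrow> bool" where
  "H_D X \<Phi> y \<kappa> C \<alpha> \<beta> m M F \<nu> \<nu>p \<longleftrightarrow>
    (\<forall>k\<ge>1. AE \<omega> in M.
       real_cond_exp M (F k) (\<lambda>\<omega>. J X \<Phi> y \<kappa> (\<nu>p k \<omega>)) \<omega> - J X \<Phi> y \<kappa> (\<nu> k \<omega>)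
       \<le> - (\<alpha> / 2) * sq_norm_in (\<nu> k \<omega>) (J' X \<Phi> y \<kappa> (\<nu> k \<omega>))
         + C * (\<alpha>\<^sup>2 / real (m k) + \<beta>\<^sup>2 + \<beta> / real (m k)))"

definition H_plus :: "'a::euclidean_space set \<Rightarrow>
    (('a set \<Rightarrow> real) \<Rightarrow> 'h::real_inner) \<Rightarrow> 'h \<Rightarrow> real \<Rightarrow>
    real \<Rightarrow> real \<Rightarrow> real \<Rightarrow> (nat \<Rightarrow> real) \<Rightarrow> (nat \<Rightarrow> nat) \<Rightarrow>
    'w measure \<Rightarrow> (nat \<Rightarrow> 'w measure) \<Rightarrow>
    (nat \<Rightarrow> 'w \<Rightarrow> 'a measure) \<Rightarrow> (nat \<Rightarrow> 'w \<Rightarrow> 'a measure) \<Rightarrow> bool" where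
  "H_plus X \<Phi> y \<kappa> c C a \<epsilon> m M Fp \<nu> \<nu>p \<longleftrightarrow>
    (\<forall>k. \<forall>B\<in>sets borel. B \<subseteq> X \<longrightarrow>
      (AE \<omega> in M.
        real_cond_exp M (Fp k) (\<lambda>\<omega>. measure (\<nu> (Suc k) \<omega>) B) \<omega>
        \<ge> c * \<epsilon> k * measure lborel (B \<inter> {t \<in> X. J' X \<Phi> y \<kappa> (\<nu>p k \<omega>) t < 0})
          - C * \<epsilon> k * real (m k) powr (- a)))"

definition H_smooth1 :: "'a::euclidean_space set \<Rightarrow>
    (('a set \<Rightarrow> real) \<Rightarrow> 'h::real_inner) \<Rightarrow> 'h \<Rightarrow> real \<Rightarrow>
    real \<Rightarrow> (nat \<Rightarrow> real) \<Rightarrow> (nat \<Rightarrow> nat) \<Rightarrow>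
    'w measure \<Rightarrow> (nat \<Rightarrow> 'w measure) \<Rightarrow>
    (nat \<Rightarrow> 'w \<Rightarrow> 'a measure) \<Rightarrow> (nat \<Rightarrow> 'w \<Rightarrow> 'a measure) \<Rightarrow> bool" where
  "H_smooth1 X \<Phi> y \<kappa> C \<epsilon> m M Fp \<nu> \<nu>p \<longleftrightarrow>
    (\<forall>k\<ge>1. AE \<omega> in M.
       real_cond_exp M (Fp k)
         (\<lambda>\<omega>. J X \<Phi> y \<kappa> (\<nu> (Suc k) \<omega>) - J X \<Phi> y \<kappa> (\<nu>p k \<omega>)) \<omega>
       \<le> C * ((\<epsilon> k)\<^sup>2 + \<epsilon> k * sqrt (ln (real (m k)) / real (m k))))"

definition H_smooth2 :: "'a::euclidean_space set \<Rightarrow>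
    (('a set \<Rightarrow> real) \<Rightarrow> 'h::real_inner) \<Rightarrow> 'h \<Rightarrow> real \<Rightarrow>
    real \<Rightarrow> (nat \<Rightarrow> real) \<Rightarrow> 'w measure \<Rightarrow>
    (nat \<Rightarrow> 'w \<Rightarrow> 'a measure) \<Rightarrow> (nat \<Rightarrow> 'w \<Rightarrow> 'a measure) \<Rightarrow> bool" where
  "H_smooth2 X \<Phi> y \<kappa> C \<epsilon> M \<nu> \<nu>p \<longleftrightarrow>
    (\<forall>k\<ge>1. AE \<omega> in M. \<forall>t\<in>X.
       \<bar>J' X \<Phi> y \<kappa> (\<nu> (Suc k) \<omega>) t - J' X \<Phi> y \<kappa> (\<nu>p k \<omega>) t\<bar> \<le> C * \<epsilon> k)"

text \<open>The generic constants \<open>c\<close> and \<open>C\<close> may be shared by all the assumptions, since each of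
  them becomes weaker when \<open>c\<close> decreases or \<open>C\<close> increases.\<close>

definition admissible_sequence :: "'a::euclidean_space set \<Rightarrow>
    (('a set \<Rightarrow> real) \<Rightarrow> 'h::real_inner) \<Rightarrow> 'h \<Rightarrow> real \<Rightarrow>
    real \<Rightarrow> real \<Rightarrow> real \<Rightarrow> real \<Rightarrow> real \<Rightarrow> real \<Rightarrow> (nat \<Rightarrow> real) \<Rightarrow> (nat \<Rightarrow> nat) \<Rightarrow>
    'w measure \<Rightarrow> (nat \<Rightarrow> 'w measure) \<Rightarrow> (nat \<Rightarrow> 'w measure) \<Rightarrow>
    (nat \<Rightarrow> 'w \<Rightarrow> 'a measure) \<Rightarrow> (nat \<Rightarrow> 'w \<Rightarrow> 'a measure) \<Rightarrow> bool" where
  "admissible_sequence X \<Phi> y \<kappa> c C CTV a \<alpha> \<beta> \<epsilon> m M F Fp \<nu> \<nu>p \<longleftrightarrow>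
    prob_space M \<and>
    interlaced_filtrations M F Fp \<and>
    adapted_measures X M F \<nu> \<and>
    adapted_measures X M Fp \<nu>p \<and>
    H_D X \<Phi> y \<kappa> C \<alpha> \<beta> m M F \<nu> \<nu>p \<and>
    H_plus X \<Phi> y \<kappa> c C a \<epsilon> m M Fp \<nu> \<nu>p \<and>
    H_smooth1 X \<Phi> y \<kappa> C \<epsilon> m M Fp \<nu> \<nu>p \<and>
    H_smooth2 X \<Phi> y \<kappa> C \<epsilon> M \<nu> \<nu>p \<and>
    H_TV X CTV M \<nu>"

definition best_gap :: "'a::topological_space set \<Rightarrow>
    (('a set \<Rightarrow> real) \<Rightarrow> 'h::real_inner) \<Rightarrow> 'h \<Rightarrow> real \<Rightarrow> 'a measure \<Rightarrow>
    (nat \<Rightarrow> 'w \<Rightarrow> 'a measure) \<Rightarrow> nat \<Rightarrow> 'w \<Rightarrow> real" where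
  "best_gap X \<Phi> y \<kappa> \<nu>star \<nu> K \<omega> = (MIN k\<in>{1..K}. J X \<Phi> y \<kappa> (\<nu> k \<omega>) - J X \<Phi> y \<kappa> \<nu>star)"

end

theory Submission
  imports Defs
begin

text \<open>
  Write \<open>\<epsilon> = 1 / \<surd>K\<close>, let \<open>d\<close> be the dimension, and call \<^emph>\<open>depth\<close> of \<open>\<nu>\<close> the supremum of the
  negative part of the gradient \<open>J\<^sub>\<nu>'\<close>. By convexity,
  \<open>J(\<nu>) - J(\<nu>\<^sup>\<star>) \<le> \<integral>J\<^sub>\<nu>' d\<nu> - \<integral>J\<^sub>\<nu>' d\<nu>\<^sup>\<star>\<close>. The first integral is controlled by the norm of
  \<open>J\<^sub>\<nu>'\<close> in \<open>L\<^sup>2(\<nu>)\<close>, the second one by the depth (\<open>obj_gap_le_sq_norm\<close>). The best gap is at most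
  the average gap, so it suffices to bound both quantities in mean over the iterations.

  The squared norms are limited by descent: the two half-steps lower the objective by \<open>\<alpha>/2\<close> times the
  squared norm up to errors, and telescoping bounds their average expectation \<open>S\<close> by a multiple of
  \<open>\<alpha> powr (- 1 - d/2) * \<surd>(ln K) / K\<close> (\<open>sum_expectation_decrease\<close>, \<open>accumulated_error_le\<close>).

  The depth is limited by exploration. The gradient is Lipschitz, because the features are, and so a
  value below \<open>- \<delta>\<close> persists, up to a constant factor, on a ball whose radius is proportional to \<open>\<delta>\<close>
  and whose intersection with the convex body \<open>X\<close> has volume of order \<open>\<delta>\<^sup>d\<close>. Exploration puts mass
  \<open>\<epsilon> \<delta>\<^sup>d\<close> there, which makes the next squared norm at least of order \<open>\<epsilon> \<delta>\<^sup>2\<^sup>+\<^sup>d\<close>. Hence the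
  depth exceeds \<open>\<delta>\<close> with probability at most of order \<open>E \<parallel>J'\<parallel>\<^sup>2 / (\<epsilon> \<delta>\<^sup>2\<^sup>+\<^sup>d)\<close>
  (\<open>prob_negative_le\<close>). Summing over dyadic levels from \<open>\<delta>\<close> on, the mean depth is at most of order
  \<open>\<delta> + S / (\<epsilon> \<delta>\<^sup>1\<^sup>+\<^sup>d)\<close> (\<open>gap_dominated\<close>). The two terms balance if
  \<open>\<delta>\<^sup>2\<^sup>+\<^sup>d\<close> is of order \<open>S / \<epsilon>\<close>. With the bound of \<open>S\<close> this means a \<open>\<delta>\<close> of
  order \<open>\<alpha> powr (- 1/2) * (ln K / K) powr (1 / (2 (2 + d)))\<close>, which is the rate. The lower bound of \<open>a\<close> is what keeps the exploration bias \<open>K powr (- a)\<close> below a multiple of \<open>\<delta>\<^sup>d\<close> at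
  this scale.

  These estimates use that \<open>\<Phi>\<nu>\<close> is the integral of the features. This is derived from weak-*
  continuity by approximating \<open>\<nu>\<close> with finite combinations of Dirac measures
  (\<open>inner_forward_operator\<close>).
\<close>

section \<open>Nonnegative measures and weak-* convergence\<close>

lemma M_plusD:
  assumes "\<nu> \<in> M_plus X"
  shows "space \<nu> = X" and "sets \<nu> = sets (borel_on X)" and "finite_measure \<nu>"
  using assms sets_eq_imp_space_eq[of \<nu> "borel_on X"] by (auto simp: M_plus_def space_restrict_space)

lemma M_plus_integrable:
  fixes f :: "'a::topological_space \<Rightarrow> real"
  assumes \<nu>: "\<nu> \<in> M_plus X" and "compact X" and f: "continuous_on X f"
  shows "integrable \<nu> f"
proof -
  interpret finite_measure \<nu> using M_plusD(3)[OF \<nu>] .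
  have meas: "f \<in> borel_measurable \<nu>"
    using borel_measurable_continuous_on_restrict[OF f] M_plusD(2)[OF \<nu>]
    by (simp cong: measurable_cong_sets)
  obtain B where "\<forall>x\<in>X. norm (f x) \<le> B"
    using compact_imp_bounded[OF compact_continuous_image[OF f \<open>compact X\<close>]]
    by (auto simp: bounded_iff)
  then show ?thesis
    by (intro integrable_const_bound[of _ B] meas) (auto simp: M_plusD(1)[OF \<nu>])
qed

lemma tv_norm_M_plus:
  assumes \<nu>: "\<nu> \<in> M_plus X"
  shows "tv_norm X (measure \<nu>) = measure \<nu> X"
proof -
  interpret finite_measure \<nu> using M_plusD(3)[OF \<nu>] .
  let ?\<P> = "{P. finite P \<and> P \<subseteq> sets (borel_on X) \<and> partition_on X P}"
  have "(\<Sum>B\<in>P. \<bar>measure \<nu> B\<bar>) = measure \<nu> X" if "P \<in> ?\<P>" for P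
  proof -
    have "measure \<nu> (\<Union>P) = (\<Sum>B\<in>P. measure \<nu> B)"
      using finite_measure_finite_Union[of P "\<lambda>B. B"] that M_plusD(2)[OF \<nu>]
      by (auto simp: partition_on_def disjoint_family_on_def disjoint_def)
    then show ?thesis using that by (simp add: partition_on_def)
  qed
  moreover have "?\<P> \<noteq> {}"
  proof (cases "X = {}")
    case True
    then have "{} \<in> ?\<P>" by (simp add: partition_on_def)
    then show ?thesis by blast
  next
    case False
    then have "{X} \<in> ?\<P>"
      using sets.top[of "borel_on X"] by (simp add: partition_on_def space_restrict_space)
    then show ?thesis by blast
  qed
  ultimately have "(\<lambda>P. \<Sum>B\<in>P. \<bar>measure \<nu> B\<bar>) ` ?\<P> = {measure \<nu> X}" by auto
  then show ?thesis by (simp add: tv_norm_def)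
qed

lemma measure_in_signed_measures:
  assumes \<nu>: "\<nu> \<in> M_plus X"
  shows "measure \<nu> \<in> signed_measures X"
proof -
  interpret finite_measure \<nu> using M_plusD(3)[OF \<nu>] .
  show ?thesis
    using finite_measure_UNION
    by (auto simp: signed_measures_def measure_notin_sets M_plusD(2)[OF \<nu>, symmetric])
qed

text \<open>The negative part of the Jordan decomposition vanishes because every supremum that
  defines it is attained at the empty set; the positive part is \<open>\<nu>\<close> itself by monotonicity.
  Thus the integral of the weak-* topology is the ordinary one on nonnegative measures.\<close>

lemma signed_integral_M_plus:
  assumes \<nu>: "\<nu> \<in> M_plus X"
  shows "signed_integral X (measure \<nu>) f = (\<integral>t. f t \<partial>\<nu>)"
proof -
  interpret finite_measure \<nu> using M_plusD(3)[OF \<nu>] .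
  note sets = M_plusD(2)[OF \<nu>] and space = M_plusD(1)[OF \<nu>]
  let ?S = "sets (borel_on X)"
  have sa: "sigma_algebra X ?S"
    using sets.sigma_algebra_axioms[of "borel_on X"] by (simp add: space_restrict_space)
  have sub: "?S \<subseteq> Pow X"
    using sets.space_closed[of "borel_on X"] by (simp add: space_restrict_space)
  have pos: "(SUP B \<in> {B \<in> ?S. B \<subseteq> A}. ennreal (measure \<nu> B)) = emeasure \<nu> A" if "A \<in> ?S" for A
  proof (rule antisym)
    show "(SUP B \<in> {B \<in> ?S. B \<subseteq> A}. ennreal (measure \<nu> B)) \<le> emeasure \<nu> A"
      using that sets by (intro SUP_least) (auto simp: emeasure_eq_measure[symmetric] intro: emeasure_mono)
    show "emeasure \<nu> A \<le> (SUP B \<in> {B \<in> ?S. B \<subseteq> A}. ennreal (measure \<nu> B))"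
      using that by (intro SUP_upper2[of A]) (auto simp: emeasure_eq_measure)
  qed
  have neg: "(SUP B \<in> {B \<in> ?S. B \<subseteq> A}. ennreal (- measure \<nu> B)) = 0" if "A \<in> ?S" for A
    by (intro antisym SUP_least) (auto simp: ennreal_neg)
  have "jordan_pos X (measure \<nu>) = measure_of X ?S (emeasure \<nu>)"
    unfolding jordan_pos_def
    by (intro measure_of_eq sub)
      (simp add: pos sigma_algebra.sigma_sets_eq[OF sa])
  also have "\<dots> = \<nu>"
    using measure_of_of_measure[of \<nu>] by (simp add: sets space)
  finally have 1: "jordan_pos X (measure \<nu>) = \<nu>" .
  have "jordan_pos X (\<lambda>A. - measure \<nu> A) = measure_of X ?S (\<lambda>_. 0)"
    unfolding jordan_pos_def
    by (intro measure_of_eq sub)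
      (simp add: neg sigma_algebra.sigma_sets_eq[OF sa])
  also have "\<dots> = null_measure (borel_on X)"
    by (simp add: null_measure_def space_restrict_space)
  finally have "jordan_pos X (\<lambda>A. - measure \<nu> A) = null_measure (borel_on X)" .
  then have 2: "(\<integral>t. f t \<partial>jordan_pos X (\<lambda>A. - measure \<nu> A)) = 0"
    by (simp add: integral_null_measure)
  show ?thesis unfolding signed_integral_def 1 2 by simp
qed

lemma return_in_M_plus:
  assumes "t \<in> X"
  shows "return (borel_on X) t \<in> M_plus X"
  using assms prob_space_return[of t "borel_on X"]
  by (auto simp: M_plus_def space_restrict_space prob_space_def)

lemma limitin_weak_star:
  assumes "\<And>n. \<mu> n \<in> signed_measures X" and "\<mu>0 \<in> signed_measures X"
    and "\<And>f. continuous_on X f \<Longrightarrow>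
      (\<lambda>n. signed_integral X (\<mu> n) f) \<longlonglongrightarrow> signed_integral X \<mu>0 f"
  shows "limitin (weak_star X) \<mu> \<mu>0 sequentially"
proof -
  let ?F = "{f :: 'a \<Rightarrow> real. continuous_on X f}"
  let ?T = "product_topology (\<lambda>_. euclideanreal) ?F"
  let ?I = "\<lambda>\<mu>. \<lambda>f \<in> ?F. signed_integral X \<mu> f"
  have lim: "limitin ?T (\<lambda>n. ?I (\<mu> n)) (?I \<mu>0) sequentially"
    using assms(3) by (auto simp: limitin_componentwise limitin_canonical_iff)
  show ?thesis
    unfolding limitin_def weak_star_def
  proof (intro conjI allI impI)
    show "\<mu>0 \<in> topspace (pullback_topology (signed_measures X) ?I ?T)"
      using assms(2) by (auto simp: topspace_pullback_topology)
  next
    fix U assume U: "openin (pullback_topology (signed_measures X) ?I ?T) U \<and> \<mu>0 \<in> U"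
    then obtain V where V: "openin ?T V" "U = ?I -` V \<inter> signed_measures X"
      by (auto simp: openin_pullback_topology)
    then have "\<forall>\<^sub>F n in sequentially. ?I (\<mu> n) \<in> V"
      using lim U by (auto simp: limitin_def)
    then show "\<forall>\<^sub>F n in sequentially. \<mu> n \<in> U"
      using assms(1) by (auto simp: V)
  qed
qed

text \<open>The only form in which weak-* continuity enters: along sequences of nonnegative
  measures.\<close>

lemma tendsto_weak_star:
  assumes "\<And>n. \<nu> n \<in> M_plus X" and "\<nu>0 \<in> M_plus X"
    and "\<And>f :: 'a::topological_space \<Rightarrow> real. continuous_on X f \<Longrightarrow> (\<lambda>n. \<integral>t. f t \<partial>\<nu> n) \<longlonglongrightarrow> (\<integral>t. f t \<partial>\<nu>0)"
    and L: "continuous_map (weak_star X) euclideanreal L"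
  shows "(\<lambda>n. L (measure (\<nu> n))) \<longlonglongrightarrow> L (measure \<nu>0)"
proof -
  have "limitin (weak_star X) (\<lambda>n. measure (\<nu> n)) (measure \<nu>0) sequentially"
    using assms(1-3)
    by (intro limitin_weak_star) (auto simp: measure_in_signed_measures signed_integral_M_plus)
  then have "limitin euclideanreal (L \<circ> (\<lambda>n. measure (\<nu> n))) (L (measure \<nu>0)) sequentially"
    by (rule continuous_map_limit[OF L])
  then show ?thesis by (simp add: limitin_canonical_iff o_def)
qed

lemma continuous_on_dirac:
  fixes X :: "'a::metric_space set"
  assumes L: "continuous_map (weak_star X) euclideanreal L"
  shows "continuous_on X (\<lambda>t. L (dirac X t))"
proof (subst continuous_on_sequentially, intro allI ballI impI)
  fix s :: "nat \<Rightarrow> 'a" and t assume t: "t \<in> X" and s: "(\<forall>n. s n \<in> X) \<and> s \<longlonglongrightarrow> t"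
  have int: "(\<integral>u. f u \<partial>return (borel_on X) t) = f t" if "continuous_on X f" "t \<in> X" for f :: "'a \<Rightarrow> real" and t
    using that borel_measurable_continuous_on_restrict[OF that(1)]
    by (intro integral_return) (auto simp: space_restrict_space)
  have "(\<lambda>n. L (measure (return (borel_on X) (s n)))) \<longlonglongrightarrow> L (measure (return (borel_on X) t))"
  proof (intro tendsto_weak_star[OF _ _ _ L] return_in_M_plus t)
    show "s n \<in> X" for n using s by simp
    fix f :: "'a \<Rightarrow> real" assume f: "continuous_on X f"
    have "(\<lambda>n. f (s n)) \<longlonglongrightarrow> f t"
      using f s t unfolding continuous_on_sequentially o_def by blast
    then show "(\<lambda>n. \<integral>u. f u \<partial>return (borel_on X) (s n)) \<longlonglongrightarrow> (\<integral>u. f u \<partial>return (borel_on X) t)"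
      using s t f by (simp add: int)
  qed
  then show "((\<lambda>t. L (dirac X t)) \<circ> s) \<longlonglongrightarrow> L (dirac X t)"
    by (simp add: o_def dirac_def)
qed


section \<open>Integral representation of the forward operator\<close>

lemma zero_signed_measure: "(\<lambda>A. 0) \<in> signed_measures X"
  by (simp add: signed_measures_def)

lemma add_signed_measures:
  "\<mu> \<in> signed_measures X \<Longrightarrow> \<nu> \<in> signed_measures X \<Longrightarrow> (\<lambda>A. \<mu> A + \<nu> A) \<in> signed_measures X"
  by (auto simp: signed_measures_def intro!: sums_add)

lemma scale_signed_measures:
  "\<mu> \<in> signed_measures X \<Longrightarrow> (\<lambda>A. r * \<mu> A) \<in> signed_measures X"
  by (auto simp: signed_measures_def intro!: sums_mult)

lemma sum_signed_measures:
  assumes "finite T" and "\<And>t. t \<in> T \<Longrightarrow> \<mu> t \<in> signed_measures X"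
  shows "(\<lambda>A. \<Sum>t\<in>T. w t * \<mu> t A) \<in> signed_measures X"
  using assms
  by (induction T rule: finite_induct)
    (simp_all add: zero_signed_measure add_signed_measures scale_signed_measures)

lemma forward_operator_add:
  assumes "forward_operator X \<Phi>" and "\<mu> \<in> signed_measures X" and "\<nu> \<in> signed_measures X"
  shows "\<Phi> (\<lambda>A. \<mu> A + \<nu> A) = \<Phi> \<mu> + \<Phi> \<nu>"
  using assms unfolding forward_operator_def by simp

lemma forward_operator_scale:
  assumes "forward_operator X \<Phi>" and "\<mu> \<in> signed_measures X"
  shows "\<Phi> (\<lambda>A. r * \<mu> A) = r *\<^sub>R \<Phi> \<mu>"
  using assms unfolding forward_operator_def by simp

lemma forward_operator_zero:
  assumes "forward_operator X \<Phi>"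
  shows "\<Phi> (\<lambda>A. 0) = 0"
  using forward_operator_scale[OF assms zero_signed_measure, of 0] by simp

lemma forward_operator_sum:
  assumes \<Phi>: "forward_operator X \<Phi>"
    and "finite T" and "\<And>t. t \<in> T \<Longrightarrow> \<mu> t \<in> signed_measures X"
  shows "\<Phi> (\<lambda>A. \<Sum>t\<in>T. w t * \<mu> t A) = (\<Sum>t\<in>T. w t *\<^sub>R \<Phi> (\<mu> t))"
  using assms(2,3)
proof (induction T rule: finite_induct)
  case empty
  then show ?case using forward_operator_zero[OF \<Phi>] by simp
next
  case (insert t T)
  have "\<Phi> (\<lambda>A. w t * \<mu> t A + (\<Sum>t\<in>T. w t * \<mu> t A))
      = \<Phi> (\<lambda>A. w t * \<mu> t A) + \<Phi> (\<lambda>A. \<Sum>t\<in>T. w t * \<mu> t A)"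
    using insert
    by (intro forward_operator_add[OF \<Phi>] scale_signed_measures sum_signed_measures) auto
  then show ?case using insert forward_operator_scale[OF \<Phi>, of "\<mu> t" "w t"] by simp
qed

lemma continuous_on_inner_feature:
  fixes X :: "'a::metric_space set"
  assumes "forward_operator X \<Phi>"
  shows "continuous_on X (\<lambda>t. inner h (feature X \<Phi> t))"
  using assms continuous_on_dirac[of X "\<lambda>\<mu>. inner h (\<Phi> \<mu>)"]
  unfolding forward_operator_def feature_def by blast

lemma integral_simple_compose:
  fixes f :: "'b \<Rightarrow> real"
  assumes "finite_measure \<nu>" and g: "simple_function \<nu> g"
  shows "(\<integral>x. f (g x) \<partial>\<nu>) = (\<Sum>t\<in>g ` space \<nu>. measure \<nu> (g -` {t} \<inter> space \<nu>) * f t)"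
proof -
  interpret finite_measure \<nu> by fact
  have fin: "finite (g ` space \<nu>)" and meas: "g -` {t} \<inter> space \<nu> \<in> sets \<nu>" for t
    using simple_functionD[OF g] by auto
  have "(\<integral>x. f (g x) \<partial>\<nu>) =
      (\<integral>x. (\<Sum>t\<in>g ` space \<nu>. f t * indicator (g -` {t} \<inter> space \<nu>) x) \<partial>\<nu>)"
  proof (intro Bochner_Integration.integral_cong refl)
    fix x assume x: "x \<in> space \<nu>"
    have "(\<Sum>t\<in>g ` space \<nu>. f t * indicator (g -` {t} \<inter> space \<nu>) x)
        = (\<Sum>t\<in>g ` space \<nu>. if t = g x then f t else 0)"
      using x by (intro sum.cong) (auto simp: indicator_def)
    also have "\<dots> = f (g x)" using fin x by simp
    finally show "f (g x) = (\<Sum>t\<in>g ` space \<nu>. f t * indicator (g -` {t} \<inter> space \<nu>) x)" by simp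
  qed
  also have "\<dots> = (\<Sum>t\<in>g ` space \<nu>. f t * measure \<nu> (g -` {t} \<inter> space \<nu>))"
    using meas by (subst Bochner_Integration.integral_sum)
      (auto intro!: integrable_mult_right integrable_real_indicator simp: less_top[symmetric])
  finally show ?thesis by (simp add: mult.commute)
qed

text \<open>The forward operator integrates the features. Simple maps \<open>g\<^sub>n\<close> from \<open>X\<close> to \<open>X\<close> that
  converge pointwise to the identity push \<open>\<nu>\<close> forward to finite combinations of Dirac measures.
  For these the formula is linearity, and both sides pass to the limit: the left one by weak-*
  continuity of \<open>\<Phi>\<close>, the right one because \<open>t \<mapsto> \<langle>h, \<phi>\<^sub>t\<rangle>\<close> is continuous, which is weak-*
  continuity again, now along Dirac measures.\<close>

theorem inner_forward_operator:
  fixes X :: "'a::euclidean_space set"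
  assumes "compact X" and "convex X" and \<Phi>: "forward_operator X \<Phi>" and \<nu>: "\<nu> \<in> M_plus X"
  shows "inner h (\<Phi> (measure \<nu>)) = (\<integral>t. inner h (feature X \<Phi> t) \<partial>\<nu>)"
proof (cases "X = {}")
  case True
  have "measure \<nu> A = 0" for A
  proof (cases "A \<in> sets \<nu>")
    case True
    then show ?thesis
      using \<open>X = {}\<close> M_plusD(1)[OF \<nu>] sets.sets_into_space[OF True] by simp
  qed (simp add: measure_notin_sets)
  then have "measure \<nu> = (\<lambda>A. 0)" by blast
  then show ?thesis
    using forward_operator_zero[OF \<Phi>] M_plusD(1)[OF \<nu>] True
    by (simp add: Bochner_Integration.integral_empty)
next
  case False
  interpret finite_measure \<nu> using M_plusD(3)[OF \<nu>] .
  note sets[measurable_cong] = M_plusD(2)[OF \<nu>] and space = M_plusD(1)[OF \<nu>]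
  have closed: "closed X" using \<open>compact X\<close> by (rule compact_imp_closed)
  have id: "(\<lambda>x. x) \<in> borel_measurable \<nu>"
    by (subst measurable_cong_sets[OF sets refl]) (intro measurable_restrict_space1 measurable_ident_sets refl)
  from borel_measurable_implies_sequence_metric[OF this, of undefined]
  obtain F where F: "\<And>i. simple_function \<nu> (F i)"
    and F_lim: "\<And>x. x \<in> X \<Longrightarrow> (\<lambda>i. F i x) \<longlonglongrightarrow> x" by (auto simp: space)
  \<comment> \<open>The simple approximations of the identity may leave \<open>X\<close>; projecting them back onto the
    convex set \<open>X\<close> keeps them simple and convergent.\<close>
  define g where "g n = closest_point X \<circ> F n" for n
  have g: "simple_function \<nu> (g n)" for n
    unfolding g_def by (intro simple_function_compose1[OF F, unfolded o_def] simple_function_compose F)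
  have g_in: "g n x \<in> X" for n x
    unfolding g_def o_def by (rule closest_point_in_set[OF closed False])
  have g_lim: "(\<lambda>n. g n x) \<longlonglongrightarrow> x" if "x \<in> X" for x
  proof -
    have "isCont (closest_point X) x"
      using continuous_on_closest_point[OF \<open>convex X\<close> closed False, of UNIV]
      by (simp add: continuous_on_eq_continuous_at)
    then have "(\<lambda>n. closest_point X (F n x)) \<longlonglongrightarrow> closest_point X x"
      using isCont_tendsto_compose F_lim[OF that] by blast
    then show ?thesis using closest_point_self[OF that] by (simp add: g_def o_def)
  qed
  have g_meas[measurable]: "g n \<in> measurable \<nu> (borel_on X)" for n
    using g_in borel_measurable_simple_function[OF g] by (intro measurable_restrict_space2) auto
  define \<nu>n where "\<nu>n n = distr \<nu> (borel_on X) (g n)" for n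
  have \<nu>n: "\<nu>n n \<in> M_plus X" for n
    unfolding \<nu>n_def M_plus_def by (simp add: finite_measure_distr)
  have lim: "(\<lambda>n. \<integral>t. f t \<partial>\<nu>n n) \<longlonglongrightarrow> (\<integral>t. f t \<partial>\<nu>)" if f: "continuous_on X f" for f :: "'a \<Rightarrow> real"
  proof -
    obtain B where B: "\<And>x. x \<in> X \<Longrightarrow> norm (f x) \<le> B"
      using compact_imp_bounded[OF compact_continuous_image[OF f \<open>compact X\<close>]]
      by (auto simp: bounded_iff)
    have f_meas[measurable]: "f \<in> borel_measurable (borel_on X)"
      by (rule borel_measurable_continuous_on_restrict[OF f])
    have "(\<lambda>n. \<integral>x. f (g n x) \<partial>\<nu>) \<longlonglongrightarrow> (\<integral>x. f x \<partial>\<nu>)"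
    proof (rule integral_dominated_convergence[where w = "\<lambda>_. B"])
      show "AE x in \<nu>. (\<lambda>n. f (g n x)) \<longlonglongrightarrow> f x"
        using f g_lim g_in unfolding continuous_on_sequentially o_def by (auto simp: space)
    qed (use B g_in in auto)
    moreover have "(\<integral>t. f t \<partial>\<nu>n n) = (\<integral>x. f (g n x) \<partial>\<nu>)" for n
      unfolding \<nu>n_def by (rule integral_distr) auto
    ultimately show ?thesis by simp
  qed
  have comb: "measure (\<nu>n n) =
      (\<lambda>A. \<Sum>t\<in>g n ` X. measure \<nu> (g n -` {t} \<inter> X) * dirac X t A)" for n
  proof
    fix A
    show "measure (\<nu>n n) A = (\<Sum>t\<in>g n ` X. measure \<nu> (g n -` {t} \<inter> X) * dirac X t A)"
    proof (cases "A \<in> sets (borel_on X)")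
      case A: True
      have "measure (\<nu>n n) A = (\<integral>t. indicator A t \<partial>\<nu>n n)"
        using A sets.sets_into_space[OF A] by (simp add: \<nu>n_def Int_absorb2)
      also have "\<dots> = (\<integral>x. indicator A (g n x) \<partial>\<nu>)"
        unfolding \<nu>n_def using A by (intro integral_distr) auto
      also have "\<dots> = (\<Sum>t\<in>g n ` X. measure \<nu> (g n -` {t} \<inter> X) * indicator A t)"
        using integral_simple_compose[OF finite_measure_axioms g] by (simp add: space)
      finally show ?thesis using A by (simp add: dirac_def measure_return)
    next
      case False
      then show ?thesis by (simp add: \<nu>n_def dirac_def measure_notin_sets)
    qed
  qed
  have "inner h (\<Phi> (measure (\<nu>n n))) = (\<integral>t. inner h (feature X \<Phi> t) \<partial>\<nu>n n)" for n
  proof -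
    have "finite (g n ` X)" using simple_functionD(1)[OF g] by (simp add: space)
    moreover have "dirac X t \<in> signed_measures X" if "t \<in> g n ` X" for t
      using that g_in measure_in_signed_measures[OF return_in_M_plus[of t X]]
      unfolding dirac_def by blast
    ultimately have "\<Phi> (measure (\<nu>n n)) =
        (\<Sum>t\<in>g n ` X. measure \<nu> (g n -` {t} \<inter> X) *\<^sub>R \<Phi> (dirac X t))"
      unfolding comb by (rule forward_operator_sum[OF \<Phi>])
    then have "inner h (\<Phi> (measure (\<nu>n n))) = (\<integral>x. inner h (feature X \<Phi> (g n x)) \<partial>\<nu>)"
      using integral_simple_compose[OF finite_measure_axioms g, of "\<lambda>t. inner h (feature X \<Phi> t)"]
      by (simp add: space inner_sum_right feature_def)
    then show ?thesis
      unfolding \<nu>n_def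
      using borel_measurable_continuous_on_restrict[OF continuous_on_inner_feature[OF \<Phi>]]
      by (subst integral_distr) auto
  qed
  then have "(\<lambda>n. inner h (\<Phi> (measure (\<nu>n n)))) \<longlonglongrightarrow> (\<integral>t. inner h (feature X \<Phi> t) \<partial>\<nu>)"
    using lim[OF continuous_on_inner_feature[OF \<Phi>, of h]] by simp
  moreover have "(\<lambda>n. inner h (\<Phi> (measure (\<nu>n n)))) \<longlonglongrightarrow> inner h (\<Phi> (measure \<nu>))"
    using \<Phi> by (intro tendsto_weak_star[where L = "\<lambda>\<mu>. inner h (\<Phi> \<mu>)", OF \<nu>n \<nu> lim])
      (auto simp: forward_operator_def)
  ultimately show ?thesis by (rule LIMSEQ_unique[rotated])
qed


section \<open>The features, the objective and its gradient\<close>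

locale measure_problem =
  fixes X :: "'a::euclidean_space set"
    and \<Phi> :: "('a set \<Rightarrow> real) \<Rightarrow> 'h::{real_inner, banach, second_countable_topology}"
    and y :: 'h and \<kappa> cP CP :: real
  assumes compact_X: "compact X" and convex_X: "convex X"
    and X_closure: "X = closure (interior X)"
    and \<Phi>: "forward_operator X \<Phi>"
    and \<kappa>: "0 < \<kappa>"
    and problem: "problem_assumption X \<Phi> y cP CP"
begin

abbreviation \<phi> :: "'a \<Rightarrow> 'h" where "\<phi> \<equiv> feature X \<Phi>"

lemma cP_pos: "0 < cP" and CP_pos: "0 < CP" and norm_y: "norm y \<le> CP"
  and kern_ge: "\<And>s t. s \<in> X \<Longrightarrow> t \<in> X \<Longrightarrow> cP \<le> inner (\<phi> s) (\<phi> t)"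
  using problem by (auto simp: problem_assumption_def kern_def)

lemma norm_feature: "t \<in> X \<Longrightarrow> norm (\<phi> t) = 1"
  using problem by (simp add: problem_assumption_def kern_def norm_eq_sqrt_inner)

text \<open>Expanding the square turns \<open>\<parallel>\<phi>\<^sub>s - \<phi>\<^sub>t\<parallel>\<^sup>2\<close> into the mixed second difference
  \<open>K(s,s) - K(s,t) - K(t,s) + K(t,t)\<close> of the kernel. Two applications of the mean value
  inequality, to \<open>u \<mapsto> K(u,s) - K(u,t)\<close> and to the derivative of \<open>K\<close>, bound it by a multiple of
  \<open>\<parallel>s - t\<parallel>\<^sup>2\<close>, because the second derivative is bounded on the compact square of \<open>X\<close>.\<close>

lemma feature_Lipschitz:
  "\<exists>L>0. \<forall>s\<in>X. \<forall>t\<in>X. norm (\<phi> s - \<phi> t) \<le> L * norm (s - t)"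
proof -
  let ?k = "\<lambda>(s, t). kern X \<Phi> s t"
  obtain D :: "'a \<times> 'a \<Rightarrow> ('a \<times> 'a) \<Rightarrow>\<^sub>L real" and D2
    where D: "\<And>z. z \<in> X \<times> X \<Longrightarrow> (?k has_derivative blinfun_apply (D z)) (at z within X \<times> X)"
      and D2: "\<And>z. z \<in> X \<times> X \<Longrightarrow> (D has_derivative blinfun_apply (D2 z)) (at z within X \<times> X)"
      and cont: "continuous_on (X \<times> X) D2"
    using problem unfolding problem_assumption_def C2_on_def by blast
  obtain B where B: "0 < B" "\<And>z. z \<in> X \<times> X \<Longrightarrow> norm (D2 z) \<le> B"
    using compact_imp_bounded[OF compact_continuous_image[OF cont compact_Times[OF compact_X compact_X]]]
    unfolding bounded_pos by auto
  have D_Lip: "norm (D z - D w) \<le> B * norm (z - w)" if "z \<in> X \<times> X" "w \<in> X \<times> X" for z w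
    by (rule differentiable_bound[OF convex_Times[OF convex_X convex_X] D2 _ that])
      (simp_all add: norm_blinfun.rep_eq[symmetric] B(2))
  have "norm (\<phi> s - \<phi> t) \<le> sqrt B * norm (s - t)" if s: "s \<in> X" and t: "t \<in> X" for s t
  proof -
    let ?h = "\<lambda>u. kern X \<Phi> u s - kern X \<Phi> u t"
    let ?h' = "\<lambda>u v. D (u, s) (v, 0) - D (u, t) (v, 0)"
    have part: "((\<lambda>u. kern X \<Phi> u r) has_derivative (\<lambda>v. D (u, r) (v, 0))) (at u within X)"
      if "u \<in> X" "r \<in> X" for u r
    proof -
      have "((\<lambda>u. (u, r)) has_derivative (\<lambda>v. (v, 0))) (at u within X)"
        by (auto intro!: derivative_eq_intros)
      moreover have "(?k has_derivative D (u, r)) (at (u, r) within (\<lambda>u. (u, r)) ` X)"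
        using that by (intro has_derivative_subset[OF D]) auto
      ultimately show ?thesis
        using has_derivative_in_compose[of "\<lambda>u. (u, r)" "\<lambda>v. (v, 0)" u X ?k "D (u, r)"] by simp
    qed
    have "norm (?h s - ?h t) \<le> (B * norm (s - t)) * norm (s - t)"
    proof (rule differentiable_bound[OF convex_X _ _ s t])
      fix u assume u: "u \<in> X"
      show "(?h has_derivative ?h' u) (at u within X)"
        using s t u by (intro has_derivative_diff part)
      have "norm (?h' u v) \<le> (B * norm (s - t)) * norm v" for v
      proof -
        have "norm (?h' u v) = norm ((D (u, s) - D (u, t)) (v, 0))"
          by (simp add: blinfun.diff_left)
        also have "\<dots> \<le> norm (D (u, s) - D (u, t)) * norm (v, 0::'a)"
          by (rule norm_blinfun)
        also have "\<dots> \<le> (B * norm ((u, s) - (u, t))) * norm (v, 0::'a)"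
          using s t u by (intro mult_right_mono D_Lip) auto
        finally show ?thesis by (simp add: norm_Pair)
      qed
      then show "onorm (?h' u) \<le> B * norm (s - t)" by (rule onorm_le)
    qed
    moreover have "?h s - ?h t = (norm (\<phi> s - \<phi> t))\<^sup>2"
      by (simp add: kern_def power2_norm_eq_inner inner_diff_left inner_diff_right inner_commute)
    ultimately have "(norm (\<phi> s - \<phi> t))\<^sup>2 \<le> B * (norm (s - t))\<^sup>2"
      by (simp add: power2_eq_square mult.assoc)
    then have "(norm (\<phi> s - \<phi> t))\<^sup>2 \<le> (sqrt B * norm (s - t))\<^sup>2"
      using B(1) by (simp add: power_mult_distrib)
    then show ?thesis by (rule power2_le_imp_le) (use B(1) in auto)
  qed
  then show ?thesis using B(1) by (intro exI[of _ "sqrt B"]) auto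
qed

lemma inner_\<Phi>:
  "\<nu> \<in> M_plus X \<Longrightarrow> inner h (\<Phi> (measure \<nu>)) = (\<integral>t. inner h (\<phi> t) \<partial>\<nu>)"
  by (rule inner_forward_operator[OF compact_X convex_X \<Phi>])

lemma integrable_inner_feature:
  "\<nu> \<in> M_plus X \<Longrightarrow> integrable \<nu> (\<lambda>t. inner h (\<phi> t))"
  by (intro M_plus_integrable[OF _ compact_X] continuous_on_inner_feature[OF \<Phi>])

text \<open>Testing \<open>\<Phi>\<nu>\<close> against itself in the integral representation, with features of norm 1.\<close>

lemma norm_\<Phi>:
  assumes \<nu>: "\<nu> \<in> M_plus X"
  shows "norm (\<Phi> (measure \<nu>)) \<le> measure \<nu> X"
proof -
  interpret finite_measure \<nu> using M_plusD(3)[OF \<nu>] .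
  let ?v = "\<Phi> (measure \<nu>)"
  have "inner ?v ?v = (\<integral>t. inner ?v (\<phi> t) \<partial>\<nu>)" by (rule inner_\<Phi>[OF \<nu>])
  also have "\<dots> \<le> (\<integral>t. norm ?v \<partial>\<nu>)"
  proof (intro integral_mono integrable_inner_feature[OF \<nu>])
    show "inner ?v (\<phi> t) \<le> norm ?v" if "t \<in> space \<nu>" for t
      using norm_cauchy_schwarz[of ?v "\<phi> t"] norm_feature[of t] that M_plusD(1)[OF \<nu>] by simp
  qed simp
  finally have "norm ?v * norm ?v \<le> norm ?v * measure \<nu> X"
    by (simp add: M_plusD(1)[OF \<nu>] mult.commute flip: power2_norm_eq_inner power2_eq_square)
  then show ?thesis
    by (cases "norm ?v = 0") (auto dest: mult_left_le_imp_le)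
qed

lemma inner_feature_\<Phi>_ge:
  assumes \<nu>: "\<nu> \<in> M_plus X" and t: "t \<in> X"
  shows "cP * measure \<nu> X \<le> inner (\<phi> t) (\<Phi> (measure \<nu>))"
proof -
  interpret finite_measure \<nu> using M_plusD(3)[OF \<nu>] .
  have "(\<integral>s. cP \<partial>\<nu>) \<le> (\<integral>s. inner (\<phi> t) (\<phi> s) \<partial>\<nu>)"
    using kern_ge[OF t] M_plusD(1)[OF \<nu>] integrable_inner_feature[OF \<nu>] by (intro integral_mono) auto
  then show ?thesis by (simp add: M_plusD(1)[OF \<nu>] inner_\<Phi>[OF \<nu>] mult.commute)
qed

abbreviation obj :: "'a measure \<Rightarrow> real" where "obj \<equiv> J X \<Phi> y \<kappa>"
abbreviation obj' :: "'a measure \<Rightarrow> 'a \<Rightarrow> real" where "obj' \<equiv> J' X \<Phi> y \<kappa>"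

lemma obj_eq:
  "\<nu> \<in> M_plus X \<Longrightarrow> obj \<nu> = 1/2 * (norm (y - \<Phi> (measure \<nu>)))\<^sup>2 + \<kappa> * measure \<nu> X"
  by (simp add: J_def tv_norm_M_plus)

lemma obj_nonneg: "\<nu> \<in> M_plus X \<Longrightarrow> 0 \<le> obj \<nu>"
  using \<kappa> by (simp add: obj_eq)

lemma norm_residual:
  assumes "\<nu> \<in> M_plus X" and "measure \<nu> X \<le> T"
  shows "norm (\<Phi> (measure \<nu>) - y) \<le> T + CP"
  using norm_\<Phi>[OF assms(1)] norm_y norm_triangle_ineq4[of "\<Phi> (measure \<nu>)" y] assms(2) by simp

lemma obj_le:
  assumes "\<nu> \<in> M_plus X" and "measure \<nu> X \<le> T"
  shows "obj \<nu> \<le> 1/2 * (T + CP)\<^sup>2 + \<kappa> * T"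
  using norm_residual[OF assms] assms \<kappa>
  by (auto simp: obj_eq norm_minus_commute intro!: add_mono power_mono)

text \<open>Since the kernel is bounded below by a positive constant, the gradient controls the mass of
  the measure. In particular it never falls below \<open>- CP\<close>.\<close>

lemma obj'_ge:
  assumes \<nu>: "\<nu> \<in> M_plus X" and t: "t \<in> X"
  shows "cP * measure \<nu> X - CP \<le> obj' \<nu> t"
  using inner_feature_\<Phi>_ge[OF assms] norm_cauchy_schwarz[of "\<phi> t" y] norm_feature[OF t] norm_y \<kappa>
  by (simp add: J'_def inner_diff_right)

lemma obj'_le:
  assumes \<nu>: "\<nu> \<in> M_plus X" and t: "t \<in> X"
  shows "obj' \<nu> t \<le> measure \<nu> X + CP + \<kappa>"
  using norm_residual[OF \<nu> order_refl] norm_cauchy_schwarz[of "\<phi> t" "\<Phi> (measure \<nu>) - y"] norm_feature[OF t]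
  by (simp add: J'_def)

lemma obj'_Lipschitz:
  assumes "\<And>s t. s \<in> X \<Longrightarrow> t \<in> X \<Longrightarrow> norm (\<phi> s - \<phi> t) \<le> L * norm (s - t)"
    and \<nu>: "\<nu> \<in> M_plus X" "measure \<nu> X \<le> T" and s: "s \<in> X" and t: "t \<in> X"
  shows "\<bar>obj' \<nu> s - obj' \<nu> t\<bar> \<le> (T + CP) * L * norm (s - t)"
proof -
  have "obj' \<nu> s - obj' \<nu> t = inner (\<phi> s - \<phi> t) (\<Phi> (measure \<nu>) - y)"
    by (simp add: J'_def inner_diff_left)
  then have "\<bar>obj' \<nu> s - obj' \<nu> t\<bar> \<le> norm (\<phi> s - \<phi> t) * norm (\<Phi> (measure \<nu>) - y)"
    using Cauchy_Schwarz_ineq2 by metis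
  also have "\<dots> \<le> (L * norm (s - t)) * (T + CP)"
    using assms(1)[OF s t] norm_residual[OF \<nu>] order_trans[OF norm_ge_zero assms(1)[OF s t]]
    by (intro mult_mono) auto
  finally show ?thesis by (simp add: mult_ac)
qed

lemma continuous_on_obj': "continuous_on X (obj' \<nu>)"
proof -
  have "obj' \<nu> = (\<lambda>t. inner (\<Phi> (measure \<nu>) - y) (\<phi> t) + \<kappa>)"
    by (auto simp: J'_def inner_commute)
  then show ?thesis
    by (simp only:) (intro continuous_intros continuous_on_inner_feature[OF \<Phi>])
qed

lemma integral_obj':
  assumes \<mu>: "\<mu> \<in> M_plus X"
  shows "(\<integral>t. obj' \<nu> t \<partial>\<mu>) = inner (\<Phi> (measure \<mu>)) (\<Phi> (measure \<nu>) - y) + \<kappa> * measure \<mu> X"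
proof -
  interpret finite_measure \<mu> using M_plusD(3)[OF \<mu>] .
  have "obj' \<nu> = (\<lambda>t. inner (\<Phi> (measure \<nu>) - y) (\<phi> t) + \<kappa>)"
    by (auto simp: J'_def inner_commute)
  then have "(\<integral>t. obj' \<nu> t \<partial>\<mu>) = (\<integral>t. inner (\<Phi> (measure \<nu>) - y) (\<phi> t) \<partial>\<mu>) + (\<integral>t. \<kappa> \<partial>\<mu>)"
    by (simp only:) (intro Bochner_Integration.integral_add integrable_inner_feature[OF \<mu>] integrable_const)
  then show ?thesis
    using inner_\<Phi>[OF \<mu>, of "\<Phi> (measure \<nu>) - y"]
    by (simp add: M_plusD(1)[OF \<mu>] inner_commute[of "\<Phi> (measure \<mu>)"] mult.commute)
qed

text \<open>The first-order convexity inequality; \<open>J\<^sub>\<nu>'\<close> is the gradient of the objective at \<open>\<nu>\<close>.\<close>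

lemma obj_gap_le:
  assumes \<nu>: "\<nu> \<in> M_plus X" and \<mu>: "\<mu> \<in> M_plus X"
  shows "obj \<nu> - obj \<mu> \<le> (\<integral>t. obj' \<nu> t \<partial>\<nu>) - (\<integral>t. obj' \<nu> t \<partial>\<mu>)"
proof -
  let ?v = "\<Phi> (measure \<nu>)" and ?w = "\<Phi> (measure \<mu>)"
  have "(norm (y - ?w))\<^sup>2 = (norm (y - ?v))\<^sup>2 + 2 * inner (?v - ?w) (y - ?v) + (norm (?v - ?w))\<^sup>2"
    by (simp add: power2_norm_eq_inner inner_diff_left inner_diff_right inner_commute)
  then have "(norm (y - ?v))\<^sup>2 \<le> (norm (y - ?w))\<^sup>2 - 2 * inner (?v - ?w) (y - ?v)"
    by simp
  then show ?thesis
    by (simp add: obj_eq[OF \<nu>] obj_eq[OF \<mu>] integral_obj'[OF \<nu>] integral_obj'[OF \<mu>]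
        inner_diff_left inner_diff_right inner_commute algebra_simps)
qed

text \<open>The free scale \<open>\<delta>\<close> linearises the Cauchy-Schwarz bound of \<open>\<integral>J\<^sub>\<nu>' d\<nu>\<close> by a multiple of
  the norm of \<open>J\<^sub>\<nu>'\<close> in \<open>L\<^sup>2(\<nu>)\<close>, so that the bound survives taking expectations.\<close>

lemma obj_gap_le_sq_norm:
  assumes \<nu>: "\<nu> \<in> M_plus X" and \<mu>: "\<mu> \<in> M_plus X" and \<delta>: "0 < \<delta>"
    and m: "\<And>t. t \<in> X \<Longrightarrow> - m \<le> obj' \<nu> t"
  shows "obj \<nu> - obj \<mu> \<le> sq_norm_in \<nu> (obj' \<nu>) / (2 * \<delta>) + \<delta> / 2 * measure \<nu> X + m * measure \<mu> X"
proof -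
  interpret \<nu>: finite_measure \<nu> using M_plusD(3)[OF \<nu>] .
  interpret \<mu>: finite_measure \<mu> using M_plusD(3)[OF \<mu>] .
  have int: "integrable \<rho> (obj' \<nu>)" "integrable \<rho> (\<lambda>t. \<bar>obj' \<nu> t\<bar>\<^sup>2)" if "\<rho> \<in> M_plus X" for \<rho>
    by (intro M_plus_integrable[OF that compact_X] continuous_intros continuous_on_obj')+
  have *: "obj' \<nu> t \<le> \<bar>obj' \<nu> t\<bar>\<^sup>2 / (2 * \<delta>) + \<delta> / 2" for t
  proof -
    have "0 \<le> (obj' \<nu> t - \<delta>)\<^sup>2 / (2 * \<delta>)" using \<delta> by simp
    also have "\<dots> = \<bar>obj' \<nu> t\<bar>\<^sup>2 / (2 * \<delta>) + \<delta> / 2 - obj' \<nu> t"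
      using \<delta> by (simp add: power2_eq_square field_simps)
    finally show ?thesis by simp
  qed
  have "(\<integral>t. obj' \<nu> t \<partial>\<nu>) \<le> (\<integral>t. \<bar>obj' \<nu> t\<bar>\<^sup>2 / (2 * \<delta>) + \<delta> / 2 \<partial>\<nu>)"
    using int[OF \<nu>] * by (intro integral_mono) auto
  also have "\<dots> = sq_norm_in \<nu> (obj' \<nu>) / (2 * \<delta>) + \<delta> / 2 * measure \<nu> X"
    using int(2)[OF \<nu>] by (simp add: sq_norm_in_def M_plusD(1)[OF \<nu>])
  finally have 1: "(\<integral>t. obj' \<nu> t \<partial>\<nu>) \<le> \<dots>" .
  have "(\<integral>t. - m \<partial>\<mu>) \<le> (\<integral>t. obj' \<nu> t \<partial>\<mu>)"
    using int(1)[OF \<mu>] m M_plusD(1)[OF \<mu>] by (intro integral_mono) auto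
  then have 2: "- (\<integral>t. obj' \<nu> t \<partial>\<mu>) \<le> m * measure \<mu> X"
    by (simp add: M_plusD(1)[OF \<mu>] mult.commute)
  show ?thesis using obj_gap_le[OF \<nu> \<mu>] 1 2 by linarith
qed

lemma sq_norm_obj'_ge:
  assumes \<nu>: "\<nu> \<in> M_plus X" and B: "B \<in> sets borel" "B \<subseteq> X" and "0 \<le> w"
    and neg: "\<And>t. t \<in> B \<Longrightarrow> obj' \<nu> t \<le> - w"
  shows "w\<^sup>2 * measure \<nu> B \<le> sq_norm_in \<nu> (obj' \<nu>)"
proof -
  interpret finite_measure \<nu> using M_plusD(3)[OF \<nu>] .
  have X: "X \<in> sets borel" using compact_X by (simp add: compact_imp_closed borel_closed)
  have B': "B \<in> sets \<nu>"
    using B X by (auto simp: M_plusD(2)[OF \<nu>] sets_restrict_space_iff)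
  have "(\<integral>t. w\<^sup>2 * indicator B t \<partial>\<nu>) \<le> (\<integral>t. \<bar>obj' \<nu> t\<bar>\<^sup>2 \<partial>\<nu>)"
  proof (intro integral_mono)
    show "integrable \<nu> (\<lambda>t. w\<^sup>2 * indicator B t)"
      using B' by (intro integrable_mult_right integrable_real_indicator) (auto simp: less_top[symmetric])
    show "integrable \<nu> (\<lambda>t. \<bar>obj' \<nu> t\<bar>\<^sup>2)"
      by (intro M_plus_integrable[OF \<nu> compact_X] continuous_intros continuous_on_obj')
    show "w\<^sup>2 * indicator B t \<le> \<bar>obj' \<nu> t\<bar>\<^sup>2" for t
      using neg[of t] \<open>0 \<le> w\<close> power_mono[of w "\<bar>obj' \<nu> t\<bar>" 2]
      by (auto simp: indicator_def)
  qed
  then show ?thesis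
    using B' sets.sets_into_space[OF B'] by (simp add: sq_norm_in_def Int_absorb2)
qed

end

section \<open>Volume of balls in a convex body\<close>

text \<open>Shrinking a ball inside \<open>X\<close> towards the point \<open>t\<close> of the convex set \<open>X\<close> by the factor
  \<open>r / E\<close>, where \<open>E\<close> exceeds the diameter, gives a ball of radius proportional to \<open>r\<close> that lies
  in \<open>X\<close> and within distance \<open>r\<close> of \<open>t\<close>. Boundary points thus see a fixed fraction of the volume
  of a full ball.\<close>

lemma volume_ball_Int_ge:
  fixes X :: "'a::euclidean_space set"
  assumes "compact X" and "convex X" and X: "X = closure (interior X)"
  shows "\<exists>v>0. \<forall>t\<in>X. \<forall>r. 0 < r \<and> r \<le> 1 \<longrightarrow> v * r ^ DIM('a) \<le> measure lborel (ball t r \<inter> X)"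
proof (cases "X = {}")
  case True
  then show ?thesis by (intro exI[of _ 1]) auto
next
  case False
  then obtain x0 where "x0 \<in> interior X" using X by fastforce
  then obtain \<rho> where \<rho>: "0 < \<rho>" "ball x0 \<rho> \<subseteq> X" by (auto simp: mem_interior)
  obtain D where D: "0 < D" "\<And>s t. s \<in> X \<Longrightarrow> t \<in> X \<Longrightarrow> dist s t < D"
  proof -
    have "dist s t < diameter X + 1" if "s \<in> X" "t \<in> X" for s t
      using diameter_bounded_bound[OF compact_imp_bounded[OF \<open>compact X\<close>] that] by simp
    moreover have "0 < diameter X + 1"
      using diameter_ge_0[OF compact_imp_bounded[OF \<open>compact X\<close>]] by simp
    ultimately show ?thesis using that by blast
  qed
  define E where "E = max D 1"
  have E: "0 < E" "1 \<le> E" "D \<le> E" using D(1) by (auto simp: E_def)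
  let ?v = "unit_ball_vol (real DIM('a)) * (\<rho> / E) ^ DIM('a)"
  have "?v * r ^ DIM('a) \<le> measure lborel (ball t r \<inter> X)" if t: "t \<in> X" and r: "0 < r" "r \<le> 1" for t r
  proof -
    define s where "s = r / E"
    have s: "0 < s" "s \<le> 1" using r E by (auto simp: s_def)
    let ?c = "(1 - s) *\<^sub>R t + s *\<^sub>R x0"
    have "ball ?c (s * \<rho>) \<subseteq> ball t r \<inter> X"
    proof
      fix u assume u: "u \<in> ball ?c (s * \<rho>)"
      define z where "z = x0 + (1 / s) *\<^sub>R (u - ?c)"
      have u_eq: "u = (1 - s) *\<^sub>R t + s *\<^sub>R z"
        using s by (simp add: z_def algebra_simps)
      have "norm (u - ?c) < s * \<rho>" using u by (simp add: dist_norm norm_minus_commute)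
      then have "norm ((1 / s) *\<^sub>R (u - ?c)) < \<rho>"
        using s by (simp add: divide_less_eq mult.commute del: scaleR_right_diff_distrib)
      then have "z \<in> ball x0 \<rho>"
        unfolding z_def mem_ball dist_norm by (metis add_diff_cancel_left' norm_minus_commute)
      then have z: "z \<in> X" using \<rho> by blast
      have "u \<in> X" using convexD_alt[OF \<open>convex X\<close> t z, of s] s by (simp add: u_eq)
      moreover have "dist t u = s * dist t z"
      proof -
        have "t - u = s *\<^sub>R (t - z)" by (simp add: u_eq algebra_simps)
        then show ?thesis using s by (simp add: dist_norm)
      qed
      then have "dist t u < s * E" using D(2)[OF t z] s E by simp
      then have "dist t u < r" using E by (simp add: s_def)
      ultimately show "u \<in> ball t r \<inter> X" by simp
    qed
    moreover have "ball t r \<inter> X \<in> fmeasurable lborel"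
    proof (rule fmeasurableI2[of "ball t r"])
      show "ball t r \<in> fmeasurable lborel"
        using emeasure_lborel_ball_finite[of t r] by (intro fmeasurableI) auto
    qed (use borel_closed[OF compact_imp_closed[OF \<open>compact X\<close>]] in auto)
    ultimately have "measure lborel (ball ?c (s * \<rho>)) \<le> measure lborel (ball t r \<inter> X)"
      by (intro measure_mono_fmeasurable) auto
    moreover have "measure lborel (ball ?c (s * \<rho>)) = ?v * r ^ DIM('a)"
    proof -
      have "measure lborel (ball ?c (s * \<rho>)) = unit_ball_vol (real DIM('a)) * (s * \<rho>) ^ DIM('a)"
        using s \<rho> by (intro content_ball) simp
      moreover have "(s * \<rho>) ^ DIM('a) = (\<rho> / E) ^ DIM('a) * r ^ DIM('a)"
        by (simp add: s_def mult.commute flip: power_mult_distrib)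
      ultimately show ?thesis by simp
    qed
    ultimately show ?thesis by simp
  qed
  moreover have "0 < ?v" using \<rho> E by (simp add: unit_ball_vol_pos)
  ultimately show ?thesis by blast
qed


section \<open>Random measures\<close>

text \<open>In a separable space the norm is determined by countably many inner products:
  \<open>\<parallel>x\<parallel> \<le> c\<close> holds if \<open>\<langle>h, x\<rangle> \<le> c \<parallel>h\<parallel>\<close> for \<open>h\<close> in a dense set, since by density \<open>h = x\<close> is then
  admissible too.\<close>

lemma borel_measurable_norm_weak:
  fixes f :: "'w \<Rightarrow> 'h::{real_inner, second_countable_topology}"
  assumes f: "\<And>h. (\<lambda>\<omega>. inner h (f \<omega>)) \<in> borel_measurable M"
  shows "(\<lambda>\<omega>. norm (f \<omega>)) \<in> borel_measurable M"
proof (subst borel_measurable_iff_le, intro allI)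
  fix c :: real
  obtain D :: "'h set" where D: "countable D"
    and dense: "\<And>U. open U \<Longrightarrow> U \<noteq> {} \<Longrightarrow> \<exists>d\<in>D. d \<in> U"
    using countable_dense_setE by blast
  show "{\<omega> \<in> space M. norm (f \<omega>) \<le> c} \<in> sets M"
  proof (cases "0 \<le> c")
    case True
    have "norm x \<le> c \<longleftrightarrow> (\<forall>h\<in>D. inner h x \<le> c * norm h)" for x
    proof
      assume "norm x \<le> c"
      have "inner h x \<le> c * norm h" for h
        using norm_cauchy_schwarz[of h x] mult_right_mono[OF \<open>norm x \<le> c\<close>, of "norm h"]
        by (simp add: mult.commute)
      then show "\<forall>h\<in>D. inner h x \<le> c * norm h" by blast
    next
      assume *: "\<forall>h\<in>D. inner h x \<le> c * norm h"
      have "closed {h. inner h x \<le> c * norm h}"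
        by (intro closed_Collect_le continuous_intros)
      then have "{h. inner h x \<le> c * norm h} = UNIV"
        using dense[of "- {h. inner h x \<le> c * norm h}"] * by (auto simp: open_closed)
      then have "inner x x \<le> c * norm x" by blast
      then have "norm x * norm x \<le> c * norm x" by (metis power2_norm_eq_inner power2_eq_square)
      then show "norm x \<le> c" using True by (cases "x = 0") auto
    qed
    then have "{\<omega> \<in> space M. norm (f \<omega>) \<le> c}
        = {\<omega> \<in> space M. \<forall>h\<in>D. inner h (f \<omega>) \<le> c * norm h}" by simp
    also have "\<dots> = (\<Inter>h\<in>D. {\<omega> \<in> space M. inner h (f \<omega>) \<le> c * norm h})"
      using dense[of UNIV] by auto
    also have "\<dots> \<in> sets M"
    proof (rule sets.countable_INT'[OF D])
      show "D \<noteq> {}" using dense[of UNIV] by auto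
      show "(\<lambda>h. {\<omega> \<in> space M. inner h (f \<omega>) \<le> c * norm h}) ` D \<subseteq> sets M"
        by (intro image_subsetI borel_measurable_le f borel_measurable_const)
    qed
    finally show ?thesis .
  next
    case False
    then have "{\<omega> \<in> space M. norm (f \<omega>) \<le> c} = {}"
      by (auto dest: order_trans[OF norm_ge_zero])
    then show ?thesis by (simp only: sets.empty_sets)
  qed
qed

text \<open>The \<open>\<sigma>\<close>-algebra \<open>M\<close> is a parameter, so that the locale applies to the filtrations as well
  as to the ambient probability space. It yields that the gradient at a point is known at the time
  of the measure, and that the objective is a random variable.\<close>

locale random_measure =
  fixes X :: "'a::topological_space set" and M :: "'w measure" and \<nu> :: "'w \<Rightarrow> 'a measure"
  assumes in_M_plus: "\<And>\<omega>. \<omega> \<in> space M \<Longrightarrow> \<nu> \<omega> \<in> M_plus X"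
    and measurable_measure[measurable]:
      "\<And>B. B \<in> sets (borel_on X) \<Longrightarrow> (\<lambda>\<omega>. measure (\<nu> \<omega>) B) \<in> borel_measurable M"
begin

lemma measurable_nn_integral:
  assumes "f \<in> borel_measurable (borel_on X)"
  shows "(\<lambda>\<omega>. \<integral>\<^sup>+t. f t \<partial>\<nu> \<omega>) \<in> borel_measurable M"
proof -
  have meas: "f \<in> borel_measurable (\<nu> \<omega>)" if "\<omega> \<in> space M" "f \<in> borel_measurable (borel_on X)"
    for \<omega> and f :: "'a \<Rightarrow> ennreal"
    using that(2) by (subst measurable_cong_sets[OF M_plusD(2)[OF in_M_plus[OF that(1)]] refl])
  show ?thesis
    using assms
  proof (induction f rule: borel_measurable_induct)
    case (cong f g)
    have "(\<integral>\<^sup>+t. f t \<partial>\<nu> \<omega>) = (\<integral>\<^sup>+t. g t \<partial>\<nu> \<omega>)" if "\<omega> \<in> space M" for \<omega>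
      using cong(3) M_plusD(1)[OF in_M_plus[OF that]]
      by (intro nn_integral_cong) (simp add: space_restrict_space)
    then show ?case using cong(4) by (simp cong: measurable_cong)
  next
    case (set A)
    have eq: "(\<integral>\<^sup>+t. indicator A t \<partial>\<nu> \<omega>) = ennreal (measure (\<nu> \<omega>) A)" if "\<omega> \<in> space M" for \<omega>
      using set M_plusD(2,3)[OF in_M_plus[OF that]]
      by (simp add: finite_measure.emeasure_eq_measure)
    show ?case
      by (subst measurable_cong[OF eq]) (assumption, intro measurable_compose[OF measurable_measure[OF set] measurable_ennreal])
  next
    case (mult u c)
    have eq: "(\<integral>\<^sup>+t. c * u t \<partial>\<nu> \<omega>) = c * (\<integral>\<^sup>+t. u t \<partial>\<nu> \<omega>)" if "\<omega> \<in> space M" for \<omega>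
      by (intro nn_integral_cmult meas that mult.hyps)
    show ?case by (subst measurable_cong[OF eq]) (assumption, intro borel_measurable_times_ennreal borel_measurable_const mult.IH)
  next
    case (add u v)
    have eq: "(\<integral>\<^sup>+t. v t + u t \<partial>\<nu> \<omega>) = (\<integral>\<^sup>+t. v t \<partial>\<nu> \<omega>) + (\<integral>\<^sup>+t. u t \<partial>\<nu> \<omega>)"
      if "\<omega> \<in> space M" for \<omega>
      by (intro nn_integral_add meas that add.hyps)
    show ?case by (subst measurable_cong[OF eq]) (assumption, intro borel_measurable_add add.IH)
  next
    case (seq U)
    have eq: "(\<integral>\<^sup>+t. (SUP i. U i) t \<partial>\<nu> \<omega>) = (SUP i. \<integral>\<^sup>+t. U i t \<partial>\<nu> \<omega>)" if "\<omega> \<in> space M" for \<omega>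
      unfolding SUP_apply
      by (intro nn_integral_monotone_convergence_SUP meas that seq.hyps)
    show ?case
      by (subst measurable_cong[OF eq]) (assumption, intro borel_measurable_SUP seq.IH countableI_type)
  qed
qed

lemma measurable_integral:
  fixes f :: "'a \<Rightarrow> real"
  assumes "compact X" and f: "continuous_on X f"
  shows "(\<lambda>\<omega>. \<integral>t. f t \<partial>\<nu> \<omega>) \<in> borel_measurable M"
proof -
  have meas[measurable]: "f \<in> borel_measurable (borel_on X)"
    by (rule borel_measurable_continuous_on_restrict[OF f])
  have "(\<integral>t. f t \<partial>\<nu> \<omega>) = enn2real (\<integral>\<^sup>+t. f t \<partial>\<nu> \<omega>) - enn2real (\<integral>\<^sup>+t. - f t \<partial>\<nu> \<omega>)"
    if "\<omega> \<in> space M" for \<omega>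
    by (rule real_lebesgue_integral_def[OF M_plus_integrable[OF in_M_plus[OF that] assms]])
  moreover have "(\<lambda>\<omega>. enn2real (\<integral>\<^sup>+t. f t \<partial>\<nu> \<omega>) - enn2real (\<integral>\<^sup>+t. - f t \<partial>\<nu> \<omega>)) \<in> borel_measurable M"
    by (intro borel_measurable_diff borel_measurable_enn2real measurable_nn_integral) measurable
  ultimately show ?thesis by (simp cong: measurable_cong)
qed

end

context measure_problem
begin

lemma
  assumes "random_measure X M \<nu>"
  shows measurable_obj': "(\<lambda>\<omega>. obj' (\<nu> \<omega>) t) \<in> borel_measurable M"
    and measurable_obj: "(\<lambda>\<omega>. obj (\<nu> \<omega>)) \<in> borel_measurable M"
proof -
  interpret random_measure X M \<nu> by fact
  have [measurable]: "(\<lambda>\<omega>. inner h (\<Phi> (measure (\<nu> \<omega>)))) \<in> borel_measurable M" for h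
    by (subst measurable_cong[OF inner_\<Phi>[OF in_M_plus]], assumption)
      (intro measurable_integral compact_X continuous_on_inner_feature \<Phi>)
  show "(\<lambda>\<omega>. obj' (\<nu> \<omega>) t) \<in> borel_measurable M"
    unfolding J'_def inner_diff_right by measurable
  have "(\<lambda>\<omega>. norm (y - \<Phi> (measure (\<nu> \<omega>)))) \<in> borel_measurable M"
    by (rule borel_measurable_norm_weak) (simp add: inner_diff_right)
  moreover have "X \<in> sets (borel_on X)"
    using sets.top[of "borel_on X"] by (simp add: space_restrict_space)
  then have "(\<lambda>\<omega>. measure (\<nu> \<omega>) X) \<in> borel_measurable M" by measurable
  ultimately have "(\<lambda>\<omega>. 1/2 * (norm (y - \<Phi> (measure (\<nu> \<omega>))))\<^sup>2 + \<kappa> * measure (\<nu> \<omega>) X)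
      \<in> borel_measurable M"
    by measurable
  then show "(\<lambda>\<omega>. obj (\<nu> \<omega>)) \<in> borel_measurable M"
    by (subst measurable_cong[OF obj_eq[OF in_M_plus]])
qed

end


section \<open>Descent and exploration along a stochastic run\<close>

text \<open>A lower bound of the conditional expectation that holds only on an event of the conditioning
  \<open>\<sigma>\<close>-algebra is still enough for a bound in mean on that event.\<close>

lemma (in finite_measure_subalgebra) integral_indicator_ge_cond_exp:
  assumes A: "A \<in> sets F" and f: "integrable M f"
    and w: "AE x in M. x \<in> A \<longrightarrow> w \<le> real_cond_exp M F f x"
  shows "w * measure M A \<le> (\<integral>x. indicator A x * f x \<partial>M)"
proof -
  have A': "A \<in> sets M" using A subalg by (auto simp: subalgebra_def)
  have int: "integrable M (\<lambda>x. indicator A x * f x)"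
    using integrable_mult_indicator[OF A' f] by simp
  have "w * measure M A = (\<integral>x. indicator A x * w \<partial>M)"
    using A' sets.sets_into_space[OF A'] by (simp add: Int_absorb2 mult.commute)
  also have "\<dots> \<le> (\<integral>x. indicator A x * real_cond_exp M F f x \<partial>M)"
  proof (rule integral_mono_AE)
    show "integrable M (\<lambda>x. indicator A x * w)"
      using A' by (intro integrable_mult_left integrable_real_indicator) (auto simp: less_top[symmetric])
    show "integrable M (\<lambda>x. indicator A x * real_cond_exp M F f x)"
      using A f int by (intro real_cond_exp_intg(1)) auto
    show "AE x in M. indicator A x * w \<le> indicator A x * real_cond_exp M F f x"
      using w by eventually_elim (auto simp: indicator_def)
  qed
  also have "\<dots> = (\<integral>x. indicator A x * f x \<partial>M)"
    using A f int by (intro real_cond_exp_intg(2)) auto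
  finally show ?thesis .
qed

text \<open>If the iterates have mass at most \<open>T\<close> and the gradient moves by at most \<open>R\<close> between
  \<open>k\<^sup>+\<close> and \<open>k + 1\<close>, then \<open>mass_bound T R\<close> bounds the mass at time \<open>k\<^sup>+\<close>.\<close>

definition (in measure_problem) mass_bound :: "real \<Rightarrow> real \<Rightarrow> real" where
  "mass_bound T R = (T + 2 * CP + \<kappa> + R) / cP"

definition (in measure_problem) obj_bound :: "real \<Rightarrow> real" where
  "obj_bound T = 1/2 * (T + CP)\<^sup>2 + \<kappa> * T"

locale stochastic_run = measure_problem X \<Phi> y \<kappa> cP CP
  for X :: "'a::euclidean_space set"
    and \<Phi> :: "('a set \<Rightarrow> real) \<Rightarrow> 'h::{real_inner, banach, second_countable_topology}"
    and y \<kappa> cP CP +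
  fixes c C CTV a \<alpha> \<beta> :: real and K :: nat and M :: "'w measure"
    and F Fp :: "nat \<Rightarrow> 'w measure" and \<nu> \<nu>p :: "nat \<Rightarrow> 'w \<Rightarrow> 'a measure"
  assumes c_pos: "0 < c" and C_pos: "0 < C" and \<alpha>_pos: "0 < \<alpha>" and \<beta>_pos: "0 < \<beta>" and K_ge: "2 \<le> K"
    and admissible: "admissible_sequence X \<Phi> y \<kappa> c C CTV a \<alpha> \<beta> (\<lambda>_. 1 / sqrt (real K)) (\<lambda>_. K)
      M F Fp \<nu> \<nu>p"
begin

sublocale prob_space M
  using admissible by (simp add: admissible_sequence_def)

abbreviation \<epsilon> :: real where "\<epsilon> \<equiv> 1 / sqrt (real K)"

lemma \<epsilon>_pos: "0 < \<epsilon>" and \<epsilon>_le: "\<epsilon> \<le> 1"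
  using K_ge by auto

lemma subalgebras: "subalgebra M (F k)" "subalgebra M (Fp k)"
  using admissible by (auto simp: admissible_sequence_def interlaced_filtrations_def)

lemma finite_measure_subalgebras:
  "finite_measure_subalgebra M (F k)" "finite_measure_subalgebra M (Fp k)"
  using subalgebras finite_measure_axioms
  by (auto simp: finite_measure_subalgebra_def finite_measure_subalgebra_axioms_def)

lemma in_M_plus: "\<omega> \<in> space M \<Longrightarrow> \<nu> k \<omega> \<in> M_plus X" "\<omega> \<in> space M \<Longrightarrow> \<nu>p k \<omega> \<in> M_plus X"
  using admissible by (auto simp: admissible_sequence_def adapted_measures_def)

lemma random_measure_Fp: "random_measure X (Fp k) (\<nu>p k)"
  using admissible subalgebras[of k]
  by (auto simp: admissible_sequence_def adapted_measures_def random_measure_def subalgebra_def)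

lemma random_measures: "random_measure X M (\<nu> k)" "random_measure X M (\<nu>p k)"
  using admissible subalgebras[of k]
  by (auto simp: admissible_sequence_def adapted_measures_def random_measure_def
      intro: measurable_from_subalg)

lemma mass_le: "AE \<omega> in M. measure (\<nu> k \<omega>) X \<le> CTV"
proof -
  have "AE \<omega> in M. tv_norm X (measure (\<nu> k \<omega>)) \<le> CTV"
    using admissible by (simp add: admissible_sequence_def H_TV_def)
  then show ?thesis
    using AE_space by eventually_elim (simp add: tv_norm_M_plus in_M_plus)
qed

lemma CTV_nonneg: "0 \<le> CTV"
proof -
  have "AE \<omega> in M. 0 \<le> CTV"
    using mass_le[of 0] by eventually_elim (erule order_trans[rotated], simp)
  then show ?thesis by (simp add: AE_const)
qed

lemma obj'_step:
  "1 \<le> k \<Longrightarrow> AE \<omega> in M. \<forall>t\<in>X. \<bar>obj' (\<nu> (Suc k) \<omega>) t - obj' (\<nu>p k \<omega>) t\<bar> \<le> C * \<epsilon>"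
  using admissible unfolding admissible_sequence_def H_smooth2_def by blast

abbreviation CTVp :: real where "CTVp \<equiv> mass_bound CTV C"

lemma CTVp_nonneg: "0 \<le> CTVp"
  using CTV_nonneg CP_pos \<kappa> C_pos cP_pos by (simp add: mass_bound_def)

text \<open>A large mass at time \<open>k\<^sup>+\<close> would force a large gradient there, hence also at time \<open>k + 1\<close>,
  where the mass and with it the gradient are bounded.\<close>

lemma massp_le:
  assumes "1 \<le> k"
  shows "AE \<omega> in M. measure (\<nu>p k \<omega>) X \<le> CTVp"
  using obj'_step[OF assms] mass_le[of "Suc k"] AE_space
proof eventually_elim
  case (elim \<omega>)
  show ?case
  proof (cases "X = {}")
    case True
    then show ?thesis using CTVp_nonneg by simp
  next
    case False
    then obtain t where t: "t \<in> X" by blast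
    have "cP * measure (\<nu>p k \<omega>) X - CP \<le> obj' (\<nu>p k \<omega>) t"
      using obj'_ge[OF in_M_plus(2) t] elim by blast
    also have "\<dots> \<le> obj' (\<nu> (Suc k) \<omega>) t + C * \<epsilon>"
      using bspec[OF elim(1) t] by linarith
    also have "\<dots> \<le> (CTV + CP + \<kappa>) + C * 1"
      using obj'_le[OF in_M_plus(1) t, of \<omega> "Suc k"] elim C_pos \<epsilon>_le
      by (intro add_mono mult_left_mono) auto
    finally show ?thesis
      using cP_pos by (simp add: mass_bound_def field_simps)
  qed
qed

lemma obj_le_bound: "AE \<omega> in M. obj (\<nu> k \<omega>) \<le> obj_bound CTV"
  using mass_le[of k] AE_space
  unfolding obj_bound_def by eventually_elim (rule obj_le[OF in_M_plus(1)])

lemma integrable_obj: "integrable M (\<lambda>\<omega>. obj (\<nu> k \<omega>))"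
proof (rule integrable_const_bound)
  show "AE \<omega> in M. norm (obj (\<nu> k \<omega>)) \<le> obj_bound CTV"
    using obj_le_bound[of k] AE_space by eventually_elim (simp add: obj_nonneg in_M_plus)
qed (rule measurable_obj[OF random_measures(1)])

lemma integrable_objp:
  assumes "1 \<le> k"
  shows "integrable M (\<lambda>\<omega>. obj (\<nu>p k \<omega>))"
proof (rule integrable_const_bound)
  show "AE \<omega> in M. norm (obj (\<nu>p k \<omega>)) \<le> obj_bound CTVp"
    using massp_le[OF assms] AE_space
  proof eventually_elim
    case (elim \<omega>)
    then show ?case
      using obj_le[OF in_M_plus(2), of \<omega> k CTVp] obj_nonneg[OF in_M_plus(2), of \<omega> k] by (simp add: obj_bound_def)
  qed
qed (rule measurable_obj[OF random_measures(2)])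

definition noise :: real where "noise = C * (\<alpha>\<^sup>2 / real K + \<beta>\<^sup>2 + \<beta> / real K)"

definition drift :: real where "drift = C * (\<epsilon>\<^sup>2 + \<epsilon> * sqrt (ln (real K) / real K))"

text \<open>An integrable upper bound of \<open>\<parallel>J\<^sub>\<nu>'\<parallel>\<^sub>\<nu>\<^sup>2\<close> at \<open>\<nu> = \<nu> k\<close>, read off from the descent
  inequality. It replaces this squared norm under every expectation, which spares a proof that the
  latter is a random variable, and its expectations telescope.\<close>

definition decrease :: "nat \<Rightarrow> 'w \<Rightarrow> real" where
  "decrease k \<omega> =
    (2 / \<alpha>) * (obj (\<nu> k \<omega>) - real_cond_exp M (F k) (\<lambda>\<omega>. obj (\<nu>p k \<omega>)) \<omega> + noise)"

lemma sq_norm_le_decrease: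
  assumes "1 \<le> k"
  shows "AE \<omega> in M. sq_norm_in (\<nu> k \<omega>) (obj' (\<nu> k \<omega>)) \<le> decrease k \<omega>"
proof -
  have "AE \<omega> in M. real_cond_exp M (F k) (\<lambda>\<omega>. obj (\<nu>p k \<omega>)) \<omega> - obj (\<nu> k \<omega>)
      \<le> - (\<alpha> / 2) * sq_norm_in (\<nu> k \<omega>) (obj' (\<nu> k \<omega>)) + noise"
    using admissible assms unfolding admissible_sequence_def H_D_def noise_def by blast
  then show ?thesis
  proof eventually_elim
    case (elim \<omega>)
    then have "(\<alpha> / 2) * sq_norm_in (\<nu> k \<omega>) (obj' (\<nu> k \<omega>))
        \<le> obj (\<nu> k \<omega>) - real_cond_exp M (F k) (\<lambda>\<omega>. obj (\<nu>p k \<omega>)) \<omega> + noise" by simp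
    then show ?case using \<alpha>_pos by (simp add: decrease_def field_simps)
  qed
qed

lemma
  assumes k: "1 \<le> k"
  shows integrable_decrease: "integrable M (decrease k)"
    and expectation_decrease:
      "expectation (decrease k) = (2 / \<alpha>) *
        (expectation (\<lambda>\<omega>. obj (\<nu> k \<omega>)) - expectation (\<lambda>\<omega>. obj (\<nu>p k \<omega>)) + noise)"
proof -
  interpret F: finite_measure_subalgebra M "F k" by (rule finite_measure_subalgebras)
  note int[simp] = integrable_obj[of k] F.real_cond_exp_int(1)[OF integrable_objp[OF k]]
  show "integrable M (decrease k)" unfolding decrease_def by simp
  show "expectation (decrease k) = (2 / \<alpha>) *
        (expectation (\<lambda>\<omega>. obj (\<nu> k \<omega>)) - expectation (\<lambda>\<omega>. obj (\<nu>p k \<omega>)) + noise)"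
    unfolding decrease_def
    by (simp add: F.real_cond_exp_int(2)[OF integrable_objp[OF k]] prob_space)
qed

lemma expectation_obj_step:
  assumes k: "1 \<le> k"
  shows "expectation (\<lambda>\<omega>. obj (\<nu> (Suc k) \<omega>)) - expectation (\<lambda>\<omega>. obj (\<nu>p k \<omega>)) \<le> drift"
proof -
  interpret Fp: finite_measure_subalgebra M "Fp k" by (rule finite_measure_subalgebras)
  let ?f = "\<lambda>\<omega>. obj (\<nu> (Suc k) \<omega>) - obj (\<nu>p k \<omega>)"
  have int: "integrable M ?f" using integrable_obj integrable_objp[OF k] by simp
  have "AE \<omega> in M. real_cond_exp M (Fp k) ?f \<omega> \<le> drift"
    using admissible k unfolding admissible_sequence_def H_smooth1_def drift_def by blast
  then have "expectation (real_cond_exp M (Fp k) ?f) \<le> drift"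
    using Fp.real_cond_exp_int(1)[OF int] by (intro integral_le_const) auto
  then show ?thesis
    using Fp.real_cond_exp_int(2)[OF int] integrable_obj integrable_objp[OF k] by simp
qed

text \<open>The sum starts at 2 because the depth of the negative part of the gradient is bounded at
  time \<open>k\<close> through the transition from \<open>k - 1\<close>, which the step bounds cover for \<open>k - 1 \<ge> 1\<close> only.\<close>

lemma sum_expectation_decrease:
  "(\<Sum>k=2..K. expectation (decrease k)) \<le> (2 / \<alpha>) * (obj_bound CTV + real K * (noise + drift))"
proof -
  let ?e = "\<lambda>k. expectation (\<lambda>\<omega>. obj (\<nu> k \<omega>))"
  have nonneg: "0 \<le> noise + drift"
    using C_pos \<beta>_pos K_ge \<epsilon>_pos unfolding noise_def drift_def
    by (intro add_nonneg_nonneg mult_nonneg_nonneg) auto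
  have "(\<Sum>k=2..K. expectation (decrease k)) \<le> (\<Sum>k=2..K. (2 / \<alpha>) * (?e k - ?e (Suc k) + (noise + drift)))"
  proof (intro sum_mono)
    fix k assume "k \<in> {2..K}"
    then have k: "1 \<le> k" by simp
    show "expectation (decrease k) \<le> (2 / \<alpha>) * (?e k - ?e (Suc k) + (noise + drift))"
      unfolding expectation_decrease[OF k]
      using expectation_obj_step[OF k] \<alpha>_pos by (intro mult_left_mono) auto
  qed
  also have "\<dots> = (2 / \<alpha>) * ((\<Sum>k=2..K. ?e k - ?e (Suc k)) + real (K - 1) * (noise + drift))"
    unfolding sum_distrib_left[symmetric] sum.distrib using K_ge by (simp add: distrib_left)
  also have "(\<Sum>k=2..K. ?e k - ?e (Suc k)) = ?e 2 - ?e (Suc K)"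
    using sum_natinterval_diff[of ?e 2 K] K_ge by simp
  also have "(2 / \<alpha>) * (?e 2 - ?e (Suc K) + real (K - 1) * (noise + drift))
      \<le> (2 / \<alpha>) * (obj_bound CTV + real K * (noise + drift))"
  proof -
    have "?e 2 \<le> obj_bound CTV"
      using obj_le_bound integrable_obj by (intro integral_le_const) auto
    moreover have "0 \<le> ?e (Suc K)"
      by (intro integral_nonneg_AE) (auto simp: obj_nonneg in_M_plus)
    ultimately show ?thesis
      using \<alpha>_pos nonneg by (intro mult_left_mono add_mono mult_right_mono) auto
  qed
  finally show ?thesis .
qed

text \<open>The exploration estimate. If the gradient at time \<open>k\<^sup>+\<close> is below \<open>- \<delta>\<close> somewhere, then, by its
  Lipschitz continuity and the choice of \<open>r\<close>, it is below \<open>- 3\<delta>/4\<close> on a ball of radius \<open>r\<close>, and at time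
  \<open>k + 1\<close> it is still below \<open>- \<delta>/2\<close> there. Exploration has placed mass of order \<open>\<epsilon> V\<close> on this ball
  in mean, so that \<open>\<parallel>J'\<parallel>\<^sup>2\<close> at time \<open>k + 1\<close> is of order \<open>\<delta>\<^sup>2 \<epsilon> V\<close>. The expectation of \<open>S\<close>
  therefore limits the probability of this event.

  The ball is random, whereas exploration is assumed for deterministic sets. Its centre can be taken
  in a finite net, and the events that a given point of the net is the first suitable one are
  disjoint and known at time \<open>k\<^sup>+\<close>.\<close>

lemma prob_negative_le:
  assumes L: "\<And>s t. s \<in> X \<Longrightarrow> t \<in> X \<Longrightarrow> norm (\<phi> s - \<phi> t) \<le> L * norm (s - t)"
    and vol: "\<And>t. t \<in> X \<Longrightarrow> V \<le> measure lborel (ball t r \<inter> X)"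
    and k: "1 \<le> k" and r: "0 < r" "(CTVp + CP) * L * r \<le> \<delta> / 8"
    and \<delta>: "0 < \<delta>" "4 * (C * \<epsilon>) \<le> \<delta>"
    and bias: "2 * (C * real K powr (- a)) \<le> c * V"
    and S: "integrable M S" "AE \<omega> in M. sq_norm_in (\<nu> (Suc k) \<omega>) (obj' (\<nu> (Suc k) \<omega>)) \<le> S \<omega>"
  shows "\<exists>E\<in>events. (AE \<omega> in M. (\<exists>t\<in>X. obj' (\<nu>p k \<omega>) t < - \<delta>) \<longrightarrow> \<omega> \<in> E) \<and>
    \<delta>\<^sup>2 * \<epsilon> * c * V * prob E \<le> 8 * expectation S"
proof -
  interpret Fp: finite_measure_subalgebra M "Fp k" by (rule finite_measure_subalgebras)
  have space_Fp: "space (Fp k) = space M" and sets_Fp: "\<And>A. A \<in> sets (Fp k) \<Longrightarrow> A \<in> events"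
    using subalgebras(2)[of k] unfolding subalgebra_def by blast+
  have "\<exists>Tn. finite Tn \<and> Tn \<subseteq> X \<and> X \<subseteq> (\<Union>t\<in>Tn. ball t r)"
    using seq_compact_imp_totally_bounded[OF compact_imp_seq_compact[OF compact_X]] r(1) by simp
  then obtain Tn where Tn: "finite Tn" "Tn \<subseteq> X" "X \<subseteq> (\<Union>t\<in>Tn. ball t r)" by auto
  obtain \<tau> :: "nat \<Rightarrow> 'a" and n where \<tau>: "Tn = \<tau> ` {i. i < n}"
    using finite_imp_nat_seg_image_inj_on[OF Tn(1)] by blast
  have \<tau>_in: "\<tau> i \<in> X" if "i < n" for i using that \<tau> Tn(2) by auto
  define E where "E i = {\<omega> \<in> space M. obj' (\<nu>p k \<omega>) (\<tau> i) < - (7/8 * \<delta>)}" for i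
  \<comment> \<open>\<open>A i\<close> is the event that \<open>\<tau> i\<close> is the first point of the net at which the gradient is
    sufficiently negative; the loss from \<open>\<delta>\<close> to \<open>7\<delta>/8\<close> pays for moving to the net.\<close>
  define A where "A = disjointed E"
  define B where "B i = ball (\<tau> i) r \<inter> X" for i
  have B: "B i \<in> sets borel" "B i \<subseteq> X" for i
    using compact_X by (auto simp: B_def compact_imp_closed borel_closed)
  have "E i \<in> sets (Fp k)" for i
    unfolding E_def space_Fp[symmetric]
    by (rule borel_measurable_less[OF measurable_obj'[OF random_measure_Fp] borel_measurable_const])
  then have A: "A i \<in> sets (Fp k)" for i
    using sets.range_disjointed_sets[of E "Fp k"] unfolding A_def by auto
  have A_sub: "A i \<subseteq> E i" for i unfolding A_def by (rule disjointed_subset)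
  have near: "obj' (\<nu>p k \<omega>) s \<le> obj' (\<nu>p k \<omega>) t + \<delta> / 8"
    if "\<omega> \<in> space M" "measure (\<nu>p k \<omega>) X \<le> CTVp" "s \<in> X" "t \<in> X" "dist s t < r" for \<omega> s t
  proof -
    have "0 \<le> L" if "s \<noteq> t"
      using order_trans[OF norm_ge_zero L[OF \<open>s \<in> X\<close> \<open>t \<in> X\<close>]] that by (simp add: zero_le_mult_iff)
    then have "(CTVp + CP) * L * norm (s - t) \<le> (CTVp + CP) * L * r \<or> s = t"
      using CTVp_nonneg CP_pos that(5) by (auto simp: dist_norm intro!: mult_left_mono)
    then show ?thesis
      using obj'_Lipschitz[OF L in_M_plus(2)[OF that(1)] that(2-4)] r(2) \<delta>(1) by auto
  qed
  have int_B: "integrable M (\<lambda>\<omega>. measure (\<nu> (Suc k) \<omega>) (B i))" for i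
  proof (rule integrable_const_bound)
    show "AE \<omega> in M. norm (measure (\<nu> (Suc k) \<omega>) (B i)) \<le> CTV"
      using mass_le[of "Suc k"] AE_space
    proof eventually_elim
      case (elim \<omega>)
      interpret finite_measure "\<nu> (Suc k) \<omega>" using M_plusD(3)[OF in_M_plus(1)] elim by blast
      have "measure (\<nu> (Suc k) \<omega>) (B i) \<le> measure (\<nu> (Suc k) \<omega>) X"
        using bounded_measure[of "B i"] by (simp add: M_plusD(1)[OF in_M_plus(1)[OF elim(2)]])
      then show ?case using elim by simp
    qed
    have "B i \<in> sets (borel_on X)"
      using B compact_X by (auto simp: sets_restrict_space_iff compact_imp_closed borel_closed)
    then show "(\<lambda>\<omega>. measure (\<nu> (Suc k) \<omega>) (B i)) \<in> borel_measurable M"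
      using random_measures(1)[of "Suc k"] by (simp add: random_measure_def)
  qed
  \<comment> \<open>The bias of the exploration estimate costs at most half of the explored mass.\<close>
  have half: "e * (c * V / 2) \<le> q"
    if "c * e * l - C * e * p \<le> q" "c * e * V \<le> c * e * l" "e * (2 * (C * p)) \<le> e * (c * V)"
    for e l p q :: real
    using that by (simp add: algebra_simps)
  have mass_B: "\<epsilon> * (c * V / 2) * prob (A i) \<le> expectation (\<lambda>\<omega>. indicator (A i) \<omega> * measure (\<nu> (Suc k) \<omega>) (B i))"
    if i: "i < n" for i
  proof (rule Fp.integral_indicator_ge_cond_exp[OF A int_B])
    have "AE \<omega> in M. c * \<epsilon> * measure lborel (B i \<inter> {t \<in> X. obj' (\<nu>p k \<omega>) t < 0})
          - C * \<epsilon> * real K powr (- a) \<le> real_cond_exp M (Fp k) (\<lambda>\<omega>. measure (\<nu> (Suc k) \<omega>) (B i)) \<omega>"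
      using admissible B[of i] unfolding admissible_sequence_def H_plus_def by blast
    then show "AE \<omega> in M. \<omega> \<in> A i \<longrightarrow>
        \<epsilon> * (c * V / 2) \<le> real_cond_exp M (Fp k) (\<lambda>\<omega>. measure (\<nu> (Suc k) \<omega>) (B i)) \<omega>"
      using massp_le[OF k]
    proof eventually_elim
      case (elim \<omega>)
      show ?case
      proof
        assume "\<omega> \<in> A i"
        then have \<omega>: "\<omega> \<in> space M" "obj' (\<nu>p k \<omega>) (\<tau> i) < - (7/8 * \<delta>)"
          using A_sub by (auto simp: E_def)
        have "obj' (\<nu>p k \<omega>) t < 0" if "t \<in> B i" for t
          using near[OF \<omega>(1) elim(2), of t "\<tau> i"] that \<tau>_in[OF i] \<omega>(2) \<delta>(1)
          by (simp add: B_def dist_commute)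
        then have "B i \<inter> {t \<in> X. obj' (\<nu>p k \<omega>) t < 0} = B i" using B(2) by blast
        then have "c * \<epsilon> * measure lborel (B i) - C * \<epsilon> * real K powr (- a)
            \<le> real_cond_exp M (Fp k) (\<lambda>\<omega>. measure (\<nu> (Suc k) \<omega>) (B i)) \<omega>" using elim(1) by simp
        moreover have "c * \<epsilon> * V \<le> c * \<epsilon> * measure lborel (B i)"
          using vol[OF \<tau>_in[OF i]] c_pos \<epsilon>_pos by (intro mult_left_mono) (auto simp: B_def)
        moreover have "\<epsilon> * (2 * (C * real K powr (- a))) \<le> \<epsilon> * (c * V)"
          using bias \<epsilon>_pos by (intro mult_left_mono) auto
        ultimately show "\<epsilon> * (c * V / 2) \<le> real_cond_exp M (Fp k) (\<lambda>\<omega>. measure (\<nu> (Suc k) \<omega>) (B i)) \<omega>"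
          by (rule half)
      qed
    qed
  qed
  have dom: "AE \<omega> in M. (\<Sum>i<n. (\<delta> / 2)\<^sup>2 * (indicator (A i) \<omega> * measure (\<nu> (Suc k) \<omega>) (B i))) \<le> S \<omega>"
    using S(2) obj'_step[OF k] massp_le[OF k] AE_space
  proof eventually_elim
    case (elim \<omega>)
    have \<nu>: "\<nu> (Suc k) \<omega> \<in> M_plus X" using elim by (intro in_M_plus)
    show ?case
    proof (cases "\<exists>j<n. \<omega> \<in> A j")
      case True
      then obtain j where j: "j < n" "\<omega> \<in> A j" by blast
      then have "\<omega> \<notin> A i" if "i \<noteq> j" for i
        using disjoint_family_disjointed[of E] that unfolding A_def disjoint_family_on_def by blast
      then have "(\<Sum>i<n. (\<delta> / 2)\<^sup>2 * (indicator (A i) \<omega> * measure (\<nu> (Suc k) \<omega>) (B i)))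
          = (\<Sum>i<n. if i = j then (\<delta> / 2)\<^sup>2 * measure (\<nu> (Suc k) \<omega>) (B j) else 0)"
        using j by (intro sum.cong) (auto simp: indicator_def)
      also have "\<dots> = (\<delta> / 2)\<^sup>2 * measure (\<nu> (Suc k) \<omega>) (B j)" using j by simp
      also have "\<dots> \<le> sq_norm_in (\<nu> (Suc k) \<omega>) (obj' (\<nu> (Suc k) \<omega>))"
      proof (rule sq_norm_obj'_ge[OF \<nu> B])
        fix t assume t: "t \<in> B j"
        have "obj' (\<nu>p k \<omega>) (\<tau> j) < - (7/8 * \<delta>)" using j(2) A_sub by (auto simp: E_def)
        then have "obj' (\<nu>p k \<omega>) t \<le> - (3/4 * \<delta>)"
          using near[OF elim(4,3), of t "\<tau> j"] t \<tau>_in[OF j(1)] by (simp add: B_def dist_commute)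
        moreover have "obj' (\<nu> (Suc k) \<omega>) t \<le> obj' (\<nu>p k \<omega>) t + C * \<epsilon>"
          using bspec[OF elim(2) subsetD[OF B(2) t]] by linarith
        ultimately show "obj' (\<nu> (Suc k) \<omega>) t \<le> - (\<delta> / 2)" using \<delta>(2) by linarith
      qed (use \<delta>(1) in simp)
      finally show ?thesis using elim(1) by linarith
    next
      case False
      then have "(\<Sum>i<n. (\<delta> / 2)\<^sup>2 * (indicator (A i) \<omega> * measure (\<nu> (Suc k) \<omega>) (B i))) = 0"
        by (intro sum.neutral) auto
      also have "\<dots> \<le> sq_norm_in (\<nu> (Suc k) \<omega>) (obj' (\<nu> (Suc k) \<omega>))"
        by (simp add: sq_norm_in_def)
      finally show ?thesis using elim(1) by linarith
    qed
  qed
  let ?E = "\<Union>i<n. E i"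
  have E_ev: "E i \<in> events" for i
    using \<open>\<And>i. E i \<in> sets (Fp k)\<close> sets_Fp by blast
  have int_AB: "integrable M (\<lambda>\<omega>. indicator (A i) \<omega> * measure (\<nu> (Suc k) \<omega>) (B i))" for i
    using integrable_mult_indicator[OF sets_Fp[OF A] int_B] by simp
  have "prob ?E = prob (\<Union>i<n. A i)"
    unfolding A_def using finite_UN_disjointed_eq[of E n] by (simp add: atLeast0LessThan)
  also have "\<dots> = (\<Sum>i<n. prob (A i))"
    using sets_Fp[OF A] disjoint_family_disjointed[of E]
    by (intro finite_measure_finite_Union) (auto simp: A_def disjoint_family_on_def)
  finally have "(\<delta> / 2)\<^sup>2 * (\<epsilon> * (c * V / 2) * prob ?E)
      = (\<Sum>i<n. (\<delta> / 2)\<^sup>2 * (\<epsilon> * (c * V / 2) * prob (A i)))"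
    by (simp add: sum_distrib_left)
  also have "\<dots> \<le> (\<Sum>i<n. (\<delta> / 2)\<^sup>2 * expectation (\<lambda>\<omega>. indicator (A i) \<omega> * measure (\<nu> (Suc k) \<omega>) (B i)))"
    using mass_B by (intro sum_mono mult_left_mono) auto
  also have "\<dots> = expectation (\<lambda>\<omega>. \<Sum>i<n. (\<delta> / 2)\<^sup>2 * (indicator (A i) \<omega> * measure (\<nu> (Suc k) \<omega>) (B i)))"
    using int_AB by (subst Bochner_Integration.integral_sum) auto
  also have "\<dots> \<le> expectation S"
    using dom S(1) int_AB
    by (intro integral_mono_AE Bochner_Integration.integrable_sum integrable_mult_right)
  finally have "(\<delta> / 2)\<^sup>2 * (\<epsilon> * (c * V / 2) * prob ?E) \<le> expectation S" .
  moreover have "\<delta>\<^sup>2 * \<epsilon> * c * V * prob ?E = 8 * ((\<delta> / 2)\<^sup>2 * (\<epsilon> * (c * V / 2) * prob ?E))"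
    by (simp add: power2_eq_square)
  ultimately have "\<delta>\<^sup>2 * \<epsilon> * c * V * prob ?E \<le> 8 * expectation S" by linarith
  moreover have "AE \<omega> in M. (\<exists>t\<in>X. obj' (\<nu>p k \<omega>) t < - \<delta>) \<longrightarrow> \<omega> \<in> ?E"
    using massp_le[OF k] AE_space
  proof eventually_elim
    case (elim \<omega>)
    show ?case
    proof
      assume "\<exists>t\<in>X. obj' (\<nu>p k \<omega>) t < - \<delta>"
      then obtain t where t: "t \<in> X" "obj' (\<nu>p k \<omega>) t < - \<delta>" by blast
      then obtain i where i: "i < n" "dist (\<tau> i) t < r" using subsetD[OF Tn(3) t(1)] \<tau> by auto
      then have "\<omega> \<in> E i"
        using near[OF elim(2,1) \<tau>_in[OF i(1)] t(1) i(2)] t(2) elim(2) by (simp add: E_def)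
      then show "\<omega> \<in> ?E" using i(1) by blast
    qed
  qed
  moreover have "?E \<in> events" using E_ev by auto
  ultimately show ?thesis by blast
qed

end


section \<open>The expected gap at a given scale\<close>

text \<open>A layer-cake bound: \<open>x\<close> exceeds the threshold \<open>\<delta>\<close> by at most the sum of the dyadic levels that
  it passes, since the levels up to \<open>2\<^sup>n \<delta>\<close> add up to \<open>(2\<^sup>n\<^sup>+\<^sup>1 - 1) \<delta>\<close>.\<close>

lemma le_sum_dyadic_levels:
  fixes x \<delta> :: real
  assumes "0 < \<delta>" and "x \<le> 2 ^ n * \<delta>"
  shows "x \<le> \<delta> + (\<Sum>j<n. 2 ^ j * \<delta> * of_bool (2 ^ j * \<delta> < x))"
  using assms(2)
proof (induction n)
  case 0
  then show ?case by simp
next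
  case (Suc n)
  show ?case
  proof (cases "x \<le> 2 ^ n * \<delta>")
    case True
    then show ?thesis using Suc.IH by simp
  next
    case False
    have "2 ^ j * \<delta> < x" if "j \<le> n" for j
    proof -
      have "2 ^ j * \<delta> \<le> 2 ^ n * \<delta>"
        using that assms(1) by (intro mult_right_mono power_increasing) auto
      then show ?thesis using False by linarith
    qed
    then have "(\<Sum>j<Suc n. 2 ^ j * \<delta> * of_bool (2 ^ j * \<delta> < x)) = (\<Sum>j<Suc n. 2 ^ j * \<delta>)"
      by (intro sum.cong) (simp_all add: less_Suc_eq_le)
    also have "\<dots> = (2 ^ Suc n - 1) * \<delta>"
      using sum_gp_strict[of "2::real" "Suc n"] by (simp add: sum_distrib_right[symmetric])
    finally show ?thesis using Suc.prems by (simp add: algebra_simps)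
  qed
qed

context stochastic_run
begin

lemma expectation_decrease_nonneg:
  assumes "1 \<le> k"
  shows "0 \<le> expectation (decrease k)"
proof (rule integral_nonneg_AE)
  show "AE \<omega> in M. 0 \<le> decrease k \<omega>"
    using sq_norm_le_decrease[OF assms]
    by eventually_elim (erule order_trans[rotated], simp add: sq_norm_in_def)
qed

text \<open>The constant in \<open>P(depth > \<delta>) \<le> level_const v \<Lambda> * E \<parallel>J'\<parallel>\<^sup>2 / (\<epsilon> \<delta>\<^sup>2\<^sup>+\<^sup>d)\<close>, where \<open>\<Lambda>\<close> is a
  Lipschitz constant of the gradient and \<open>v r\<^sup>d\<close> bounds the volume of the balls from below.\<close>

definition level_const :: "real \<Rightarrow> real \<Rightarrow> real" where
  "level_const v \<Lambda> = 8 * (8 * \<Lambda>) ^ DIM('a) / (c * v)"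

text \<open>The exploration estimate at the dyadic levels \<open>2\<^sup>j \<delta>\<close> bounds the expected depth of the
  gradient: level \<open>j\<close> contributes \<open>2\<^sup>j \<delta>\<close> times a probability of order \<open>(2\<^sup>j \<delta>)\<^sup>-\<^sup>2\<^sup>-\<^sup>d\<close>, so the
  series is geometric and the smallest level \<open>\<delta>\<close> dominates. Levels above \<open>CP\<close> are never reached,
  which leaves finitely many of them. The dominating variable \<open>U\<close> is explicit and integrable.\<close>

lemma gap_dominated:
  assumes \<nu>star: "\<nu>star \<in> M_plus X"
    and L: "\<And>s t. s \<in> X \<Longrightarrow> t \<in> X \<Longrightarrow> norm (\<phi> s - \<phi> t) \<le> L * norm (s - t)" "1 \<le> L"
    and vol: "0 < v"
      "\<And>t r. t \<in> X \<Longrightarrow> 0 < r \<Longrightarrow> r \<le> 1 \<Longrightarrow> v * r ^ DIM('a) \<le> measure lborel (ball t r \<inter> X)"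
    and \<Lambda>: "\<Lambda> = (CTVp + CP) * L"
    and \<delta>: "0 < \<delta>" "4 * (C * \<epsilon>) \<le> \<delta>"
    and bias: "2 * (C * real K powr (- a)) \<le> c * (v * (\<delta> / (8 * \<Lambda>)) ^ DIM('a))"
    and k: "1 \<le> k"
  shows "\<exists>U. integrable M U \<and> (AE \<omega> in M. obj (\<nu> (Suc k) \<omega>) - obj \<nu>star \<le> U \<omega>) \<and>
    expectation U \<le> expectation (decrease (Suc k)) *
        (1 / (2 * \<delta>) + 2 * level_const v \<Lambda> * measure \<nu>star X / (\<epsilon> * \<delta> ^ (1 + DIM('a)))) +
      \<delta> * (CTV / 2 + measure \<nu>star X) + measure \<nu>star X * (C * \<epsilon>)"
proof -
  let ?d = "DIM('a)" and ?q = "expectation (decrease (Suc k))" and ?m = "measure \<nu>star X"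
  have \<Lambda>_ge: "CP \<le> \<Lambda>"
    using mult_mono[of CP "CTVp + CP" 1 L] CTVp_nonneg CP_pos L(2) by (simp add: \<Lambda>)
  then have \<Lambda>_pos: "0 < \<Lambda>" using CP_pos by simp
  define n where "n = (LEAST n. CP / \<delta> < 2 ^ n)"
  have "\<exists>n. CP / \<delta> < (2::real) ^ n" by (rule real_arch_pow) simp
  then have "CP / \<delta> < 2 ^ n" unfolding n_def by (rule LeastI_ex)
  then have n: "CP \<le> 2 ^ n * \<delta>" using \<delta>(1) by (simp add: field_simps)
  have level_le: "2 ^ j * \<delta> \<le> CP" if "j < n" for j
    using not_less_Least[OF that[unfolded n_def]] \<delta>(1) by (simp add: field_simps)
  have level_ge: "\<delta> \<le> 2 ^ j * \<delta>" for j using \<delta>(1) by simp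
  have "\<exists>E\<in>events. (AE \<omega> in M. (\<exists>t\<in>X. obj' (\<nu>p k \<omega>) t < - (2 ^ j * \<delta>)) \<longrightarrow> \<omega> \<in> E) \<and>
      (2 ^ j * \<delta>)\<^sup>2 * \<epsilon> * c * (v * (2 ^ j * \<delta> / (8 * \<Lambda>)) ^ ?d) * prob E \<le> 8 * ?q"
    if j: "j < n" for j
  proof (rule prob_negative_le[OF L(1) _ k])
    let ?r = "2 ^ j * \<delta> / (8 * \<Lambda>)"
    show r: "0 < ?r" using \<delta>(1) \<Lambda>_pos by simp
    show "(CTVp + CP) * L * ?r \<le> 2 ^ j * \<delta> / 8"
      unfolding \<Lambda>[symmetric] using \<Lambda>_pos by simp
    show "v * ?r ^ ?d \<le> measure lborel (ball t ?r \<inter> X)" if "t \<in> X" for t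
      using vol(2)[OF that r] level_le[OF j] \<Lambda>_ge \<Lambda>_pos by simp
    show "0 < 2 ^ j * \<delta>" "4 * (C * \<epsilon>) \<le> 2 ^ j * \<delta>" using \<delta> level_ge[of j] by linarith+
    have "(\<delta> / (8 * \<Lambda>)) ^ ?d \<le> ?r ^ ?d"
      using level_ge \<delta>(1) \<Lambda>_pos by (intro power_mono divide_right_mono) auto
    then have "c * (v * (\<delta> / (8 * \<Lambda>)) ^ ?d) \<le> c * (v * ?r ^ ?d)"
      using c_pos vol(1) by (intro mult_left_mono) auto
    then show "2 * (C * real K powr (- a)) \<le> c * (v * ?r ^ ?d)" using bias by linarith
    show "integrable M (decrease (Suc k))" by (rule integrable_decrease) simp
    show "AE \<omega> in M. sq_norm_in (\<nu> (Suc k) \<omega>) (obj' (\<nu> (Suc k) \<omega>)) \<le> decrease (Suc k) \<omega>"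
      by (rule sq_norm_le_decrease) simp
  qed
  then have "\<forall>j\<in>{..<n}. \<exists>E. E \<in> events \<and>
      (AE \<omega> in M. (\<exists>t\<in>X. obj' (\<nu>p k \<omega>) t < - (2 ^ j * \<delta>)) \<longrightarrow> \<omega> \<in> E) \<and>
      (2 ^ j * \<delta>)\<^sup>2 * \<epsilon> * c * (v * (2 ^ j * \<delta> / (8 * \<Lambda>)) ^ ?d) * prob E \<le> 8 * ?q"
    by (simp add: Bex_def)
  from bchoice[OF this] obtain E where
    *: "\<forall>j\<in>{..<n}. E j \<in> events \<and>
      (AE \<omega> in M. (\<exists>t\<in>X. obj' (\<nu>p k \<omega>) t < - (2 ^ j * \<delta>)) \<longrightarrow> \<omega> \<in> E j) \<and>
      (2 ^ j * \<delta>)\<^sup>2 * \<epsilon> * c * (v * (2 ^ j * \<delta> / (8 * \<Lambda>)) ^ ?d) * prob (E j) \<le> 8 * ?q" ..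
  have E: "E j \<in> events"
    and E_neg: "AE \<omega> in M. (\<exists>t\<in>X. obj' (\<nu>p k \<omega>) t < - (2 ^ j * \<delta>)) \<longrightarrow> \<omega> \<in> E j"
    and E_prob: "(2 ^ j * \<delta>)\<^sup>2 * \<epsilon> * c * (v * (2 ^ j * \<delta> / (8 * \<Lambda>)) ^ ?d) * prob (E j) \<le> 8 * ?q"
    if "j < n" for j
    using bspec[OF *, of j] that by simp_all
  define N where "N \<omega> = (\<Sum>j<n. 2 ^ j * \<delta> * indicator (E j) \<omega> :: real)" for \<omega>
  define U where "U \<omega> = decrease (Suc k) \<omega> / (2 * \<delta>) + \<delta> / 2 * CTV + (C * \<epsilon> + \<delta> + N \<omega>) * ?m" for \<omega>
  have int_ind: "integrable M (indicator (E j) :: _ \<Rightarrow> real)" if "j < n" for j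
    using E[OF that] by (intro integrable_real_indicator) (auto simp: less_top[symmetric])
  have int_N: "integrable M N"
    unfolding N_def using int_ind by (intro Bochner_Integration.integrable_sum integrable_mult_right) auto
  have int_dec: "integrable M (decrease (Suc k))" by (rule integrable_decrease) simp
  have int_U: "integrable M U"
    unfolding U_def using int_N int_dec by simp
  have dom: "AE \<omega> in M. obj (\<nu> (Suc k) \<omega>) - obj \<nu>star \<le> U \<omega>"
  proof -
    have "AE \<omega> in M. \<forall>j\<in>{..<n}. (\<exists>t\<in>X. obj' (\<nu>p k \<omega>) t < - (2 ^ j * \<delta>)) \<longrightarrow> \<omega> \<in> E j"
      using E_neg by (intro AE_finite_allI) auto
    moreover have "AE \<omega> in M. sq_norm_in (\<nu> (Suc k) \<omega>) (obj' (\<nu> (Suc k) \<omega>)) \<le> decrease (Suc k) \<omega>"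
      by (rule sq_norm_le_decrease) simp
    ultimately show ?thesis
      using obj'_step[OF k] mass_le[of "Suc k"] AE_space
    proof eventually_elim
      case (elim \<omega>)
      have \<nu>: "\<nu> (Suc k) \<omega> \<in> M_plus X" "\<nu>p k \<omega> \<in> M_plus X" using elim by (auto intro: in_M_plus)
      have "- (C * \<epsilon> + \<delta> + N \<omega>) \<le> obj' (\<nu> (Suc k) \<omega>) t" if t: "t \<in> X" for t
      proof -
        let ?x = "- obj' (\<nu>p k \<omega>) t"
        have "0 \<le> cP * measure (\<nu>p k \<omega>) X" using cP_pos by simp
        then have "?x \<le> CP" using obj'_ge[OF \<nu>(2) t] by linarith
        then have "?x \<le> \<delta> + (\<Sum>j<n. 2 ^ j * \<delta> * of_bool (2 ^ j * \<delta> < ?x))"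
          using n by (intro le_sum_dyadic_levels[OF \<delta>(1)]) simp
        also have "\<dots> \<le> \<delta> + N \<omega>"
          unfolding N_def
        proof (intro add_left_mono sum_mono mult_left_mono)
          fix j assume j: "j \<in> {..<n}"
          show "of_bool (2 ^ j * \<delta> < ?x) \<le> (indicator (E j) \<omega> :: real)"
          proof (cases "2 ^ j * \<delta> < ?x")
            case True
            then have "\<omega> \<in> E j" using bspec[OF elim(1) j] t by fastforce
            then show ?thesis by simp
          qed simp
        qed (use \<delta>(1) in simp)
        finally show ?thesis using bspec[OF elim(3) t] by linarith
      qed
      then have "obj (\<nu> (Suc k) \<omega>) - obj \<nu>star \<le>
          sq_norm_in (\<nu> (Suc k) \<omega>) (obj' (\<nu> (Suc k) \<omega>)) / (2 * \<delta>) + \<delta> / 2 * measure (\<nu> (Suc k) \<omega>) X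
          + (C * \<epsilon> + \<delta> + N \<omega>) * ?m"
        by (rule obj_gap_le_sq_norm[OF \<nu>(1) \<nu>star \<delta>(1)])
      also have "\<dots> \<le> U \<omega>"
        unfolding U_def using elim(2,4) \<delta>(1)
        by (intro add_right_mono add_mono divide_right_mono mult_left_mono) auto
      finally show ?case .
    qed
  qed
  have q: "0 \<le> ?q" by (rule expectation_decrease_nonneg) simp
  let ?W = "level_const v \<Lambda>"
  have W: "0 < ?W" using \<Lambda>_pos c_pos vol(1) by (simp add: level_const_def)
  have E_prob': "2 ^ j * \<delta> * prob (E j) \<le> ?W * ?q / (\<epsilon> * \<delta> ^ (1 + ?d)) * (1 / 2) ^ j" if j: "j < n" for j
  proof -
    let ?\<delta>j = "2 ^ j * \<delta>"
    have \<delta>j: "0 < ?\<delta>j" using \<delta>(1) by simp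
    have eq: "?\<delta>j\<^sup>2 * \<epsilon> * c * (v * (?\<delta>j / (8 * \<Lambda>)) ^ ?d) * p = (\<epsilon> * ?\<delta>j ^ (1 + ?d) * (8 / ?W)) * (?\<delta>j * p)" for p
      using c_pos vol(1) \<Lambda>_pos by (simp add: level_const_def power_divide power2_eq_square)
    have "(\<epsilon> * ?\<delta>j ^ (1 + ?d) * (8 / ?W)) * (?\<delta>j * prob (E j)) \<le> 8 * ?q"
      using E_prob[OF j] unfolding eq .
    moreover have "0 < \<epsilon> * ?\<delta>j ^ (1 + ?d) * (8 / ?W)"
      using \<epsilon>_pos \<delta>(1) W by (intro mult_pos_pos zero_less_power divide_pos_pos) auto
    ultimately have "?\<delta>j * prob (E j) \<le> 8 * ?q / (\<epsilon> * ?\<delta>j ^ (1 + ?d) * (8 / ?W))"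
      by (subst pos_le_divide_eq) (simp_all only: mult.commute)
    also have "\<dots> = ?W * ?q / (\<epsilon> * ?\<delta>j ^ (1 + ?d))"
      using \<epsilon>_pos \<delta>(1) W by (simp add: field_simps)
    also have "\<dots> \<le> ?W * ?q / (\<epsilon> * (2 ^ j * \<delta> ^ (1 + ?d)))"
    proof (intro divide_left_mono mult_left_mono)
      have "(2::real) ^ j \<le> (2 ^ j) ^ (1 + ?d)" by (rule self_le_power) auto
      then have "2 ^ j * \<delta> ^ (1 + ?d) \<le> (2 ^ j) ^ (1 + ?d) * \<delta> ^ (1 + ?d)"
        using \<delta>(1) by (intro mult_right_mono) auto
      then show "2 ^ j * \<delta> ^ (1 + ?d) \<le> ?\<delta>j ^ (1 + ?d)" by (simp only: power_mult_distrib)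
    qed (use \<epsilon>_pos \<delta>(1) \<delta>j W q in auto)
    finally show ?thesis by (simp add: power_one_over field_simps)
  qed
  have "expectation N = (\<Sum>j<n. 2 ^ j * \<delta> * prob (E j))"
    unfolding N_def using int_ind E
    by (subst Bochner_Integration.integral_sum) (auto simp: Int_absorb2 sets.sets_into_space)
  also have "\<dots> \<le> (\<Sum>j<n. ?W * ?q / (\<epsilon> * \<delta> ^ (1 + ?d)) * (1 / 2) ^ j)"
    using E_prob' by (intro sum_mono) auto
  also have "\<dots> = ?W * ?q / (\<epsilon> * \<delta> ^ (1 + ?d)) * (\<Sum>j<n. (1 / 2) ^ j)"
    by (simp only: sum_distrib_left)
  also have "\<dots> \<le> ?W * ?q / (\<epsilon> * \<delta> ^ (1 + ?d)) * 2"
    using \<epsilon>_pos \<delta>(1) W q sum_gp_strict[of "1/2::real" n] by (intro mult_left_mono) auto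
  finally have N: "expectation N \<le> ?W * ?q / (\<epsilon> * \<delta> ^ (1 + ?d)) * 2" .
  have "expectation U = ?q / (2 * \<delta>) + \<delta> / 2 * CTV + (C * \<epsilon> + \<delta> + expectation N) * ?m"
    unfolding U_def using int_N int_dec by (simp add: prob_space)
  also have "\<dots> \<le> ?q / (2 * \<delta>) + \<delta> / 2 * CTV + (C * \<epsilon> + \<delta> + ?W * ?q / (\<epsilon> * \<delta> ^ (1 + ?d)) * 2) * ?m"
    using N by (intro add_left_mono mult_right_mono) auto
  also have "\<dots> = ?q * (1 / (2 * \<delta>) + 2 * ?W * ?m / (\<epsilon> * \<delta> ^ (1 + ?d)))
      + \<delta> * (CTV / 2 + ?m) + ?m * (C * \<epsilon>)"
    by (simp add: algebra_simps)
  finally show ?thesis using int_U dom by blast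
qed

lemma best_gap_le:
  assumes "k \<in> {1..K}"
  shows "best_gap X \<Phi> y \<kappa> \<nu>star \<nu> K \<omega> \<le> obj (\<nu> k \<omega>) - obj \<nu>star"
  unfolding best_gap_def using assms by (intro Min_le) auto

lemma best_gap_nonneg:
  assumes "\<And>\<mu>. \<mu> \<in> M_plus X \<Longrightarrow> obj \<nu>star \<le> obj \<mu>" and "\<omega> \<in> space M"
  shows "0 \<le> best_gap X \<Phi> y \<kappa> \<nu>star \<nu> K \<omega>"
  unfolding best_gap_def using assms K_ge by (subst Min_ge_iff) (auto intro: in_M_plus)

lemma expectation_best_gap_le_obj_bound:
  assumes \<nu>star: "\<nu>star \<in> M_plus X" "\<And>\<mu>. \<mu> \<in> M_plus X \<Longrightarrow> obj \<nu>star \<le> obj \<mu>"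
  shows "expectation (best_gap X \<Phi> y \<kappa> \<nu>star \<nu> K) \<le> obj_bound CTV"
proof -
  have dom: "AE \<omega> in M. best_gap X \<Phi> y \<kappa> \<nu>star \<nu> K \<omega> \<le> obj_bound CTV"
    using obj_le_bound[of 1] AE_space
  proof eventually_elim
    case (elim \<omega>)
    then show ?case
      using best_gap_le[of 1 \<nu>star \<omega>] obj_nonneg[OF \<nu>star(1)] K_ge by simp
  qed
  have "AE \<omega> in M. 0 \<le> obj_bound CTV"
    using dom AE_space by eventually_elim (use best_gap_nonneg[OF \<nu>star(2)] order_trans in blast)
  then have "expectation (best_gap X \<Phi> y \<kappa> \<nu>star \<nu> K) \<le> expectation (\<lambda>_. obj_bound CTV)"
    using dom by (intro integral_mono_AE') auto
  then show ?thesis by (simp add: prob_space)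
qed

text \<open>The minimum over the iterations is at most the average over \<open>2..K\<close>, and the bound of the
  single gap is affine in the expected decrease, so averaging only requires the telescoped sum. The
  scale \<open>\<delta>\<close> is still free.\<close>

theorem expectation_best_gap_le:
  assumes \<nu>star: "\<nu>star \<in> M_plus X" "\<And>\<mu>. \<mu> \<in> M_plus X \<Longrightarrow> obj \<nu>star \<le> obj \<mu>"
    and L: "\<And>s t. s \<in> X \<Longrightarrow> t \<in> X \<Longrightarrow> norm (\<phi> s - \<phi> t) \<le> L * norm (s - t)" "1 \<le> L"
    and vol: "0 < v"
      "\<And>t r. t \<in> X \<Longrightarrow> 0 < r \<Longrightarrow> r \<le> 1 \<Longrightarrow> v * r ^ DIM('a) \<le> measure lborel (ball t r \<inter> X)"
    and \<Lambda>: "\<Lambda> = (CTVp + CP) * L"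
    and \<delta>: "0 < \<delta>" "4 * (C * \<epsilon>) \<le> \<delta>"
    and bias: "2 * (C * real K powr (- a)) \<le> c * (v * (\<delta> / (8 * \<Lambda>)) ^ DIM('a))"
  shows "expectation (best_gap X \<Phi> y \<kappa> \<nu>star \<nu> K) \<le>
    (4 / (\<alpha> * real K)) * (obj_bound CTV + real K * (noise + drift)) *
        (1 / (2 * \<delta>) + 2 * level_const v \<Lambda> * measure \<nu>star X / (\<epsilon> * \<delta> ^ (1 + DIM('a)))) +
      \<delta> * (CTV / 2 + measure \<nu>star X) + measure \<nu>star X * (C * \<epsilon>)"
    (is "_ \<le> ?S * ?A + ?B + ?B'")
proof -
  let ?g = "best_gap X \<Phi> y \<kappa> \<nu>star \<nu> K"
  have "\<exists>U. integrable M U \<and> (AE \<omega> in M. obj (\<nu> k \<omega>) - obj \<nu>star \<le> U \<omega>) \<and>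
      expectation U \<le> expectation (decrease k) * ?A + ?B + ?B'" if k: "k \<in> {2..K}" for k
  proof -
    obtain l where "k = Suc l" "1 \<le> l" using k by (cases k) auto
    then show ?thesis using gap_dominated[OF \<nu>star(1) L vol \<Lambda> \<delta> bias, of l] by simp
  qed
  then have "\<forall>k\<in>{2..K}. \<exists>U. integrable M U \<and> (AE \<omega> in M. obj (\<nu> k \<omega>) - obj \<nu>star \<le> U \<omega>) \<and>
      expectation U \<le> expectation (decrease k) * ?A + ?B + ?B'" by blast
  from bchoice[OF this] obtain U where
    *: "\<forall>k\<in>{2..K}. integrable M (U k) \<and> (AE \<omega> in M. obj (\<nu> k \<omega>) - obj \<nu>star \<le> U k \<omega>) \<and>
      expectation (U k) \<le> expectation (decrease k) * ?A + ?B + ?B'" ..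
  have U: "integrable M (U k)"
    and dom: "AE \<omega> in M. obj (\<nu> k \<omega>) - obj \<nu>star \<le> U k \<omega>"
    and EU: "expectation (U k) \<le> expectation (decrease k) * ?A + ?B + ?B'"
    if "k \<in> {2..K}" for k
    using bspec[OF * that] by simp_all
  have K1: "0 < real K - 1" "real (card {2..K}) = real K - 1" using K_ge by auto
  have "AE \<omega> in M. \<forall>k\<in>{2..K}. obj (\<nu> k \<omega>) - obj \<nu>star \<le> U k \<omega>"
    using dom by (intro AE_finite_allI) auto
  then have le: "AE \<omega> in M. ?g \<omega> \<le> (\<Sum>k=2..K. U k \<omega>) / (real K - 1)"
  proof eventually_elim
    case (elim \<omega>)
    have "(\<Sum>k=2..K. ?g \<omega>) \<le> (\<Sum>k=2..K. U k \<omega>)"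
    proof (rule sum_mono)
      fix k assume k: "k \<in> {2..K}"
      then show "?g \<omega> \<le> U k \<omega>" using best_gap_le[of k \<nu>star \<omega>] bspec[OF elim k] by auto
    qed
    then show ?case using K1 by (simp add: pos_le_divide_eq mult.commute)
  qed
  have "AE \<omega> in M. 0 \<le> (\<Sum>k=2..K. U k \<omega>) / (real K - 1)"
    using le AE_space by eventually_elim (use best_gap_nonneg[OF \<nu>star(2)] order_trans in blast)
  then have "expectation ?g \<le> expectation (\<lambda>\<omega>. (\<Sum>k=2..K. U k \<omega>) / (real K - 1))"
    using le U
    by (intro integral_mono_AE' integrable_divide Bochner_Integration.integrable_sum) auto
  also have "\<dots> = (\<Sum>k=2..K. expectation (U k)) / (real K - 1)"
    using U by (simp add: Bochner_Integration.integral_sum)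
  also have "\<dots> \<le> (\<Sum>k=2..K. expectation (decrease k) * ?A + (?B + ?B')) / (real K - 1)"
    using EU K1 by (intro divide_right_mono sum_mono) (auto simp: add.assoc)
  also have "\<dots> = (\<Sum>k=2..K. expectation (decrease k)) / (real K - 1) * ?A + (?B + ?B')"
    using K1 unfolding sum.distrib sum_distrib_right[symmetric] sum_constant
    by (simp add: add_divide_distrib del: sum_constant)
  also have "\<dots> \<le> ?S * ?A + (?B + ?B')"
  proof (intro add_right_mono mult_right_mono)
    let ?N = "obj_bound CTV + real K * (noise + drift)"
    have "(\<Sum>k=2..K. expectation (decrease k)) / (real K - 1) \<le> (2 / \<alpha> * ?N) / (real K - 1)"
      using sum_expectation_decrease K1 by (intro divide_right_mono) auto
    also have "\<dots> \<le> (2 / \<alpha> * ?N) / (real K / 2)"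
    proof (rule divide_left_mono)
      have "0 \<le> (\<Sum>k=2..K. expectation (decrease k))"
        by (intro sum_nonneg expectation_decrease_nonneg) auto
      then show "0 \<le> 2 / \<alpha> * ?N" using sum_expectation_decrease by linarith
    qed (use K_ge in auto)
    finally show "(\<Sum>k=2..K. expectation (decrease k)) / (real K - 1) \<le> ?S" by simp
    have "0 \<le> level_const v \<Lambda>"
      using CTVp_nonneg CP_pos L(2) c_pos vol(1) by (simp add: level_const_def \<Lambda>)
    then show "0 \<le> ?A" using \<delta>(1) \<epsilon>_pos by (intro add_nonneg_nonneg divide_nonneg_nonneg mult_nonneg_nonneg) auto
  qed
  finally show ?thesis by (simp add: add.assoc)
qed

end


section \<open>The rate of convergence\<close>

text \<open>The right-hand side of the theorem up to constants, with \<open>K\<close> in place of the number \<open>K\<^sup>2\<close> of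
  oracle calls; \<open>D\<close> is the dimension.\<close>

definition rate :: "nat \<Rightarrow> nat \<Rightarrow> real \<Rightarrow> real" where
  "rate D K \<alpha> = \<alpha> powr (- 1 / 2) * (ln (real K) / real K) powr (1 / (2 * (2 + real D)))"

lemma rate_pos:
  assumes "2 \<le> K" and "0 < \<alpha>"
  shows "0 < rate D K \<alpha>"
  using assms by (simp add: rate_def)

text \<open>Times \<open>1 / \<surd>K\<close>, this power is the order of the average expected decrease: the rate is chosen as the
  scale at which the two terms of the depth bound balance.\<close>

lemma rate_power:
  assumes K: "2 \<le> K" and \<alpha>: "0 < \<alpha>"
  shows "rate D K \<alpha> ^ (2 + D) = \<alpha> powr (- (1 + real D / 2)) * sqrt (ln (real K) / real K)"
proof -
  let ?s = "ln (real K) / real K" and ?d = "2 + real D"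
  have s: "0 < ?s" using K by simp
  have "rate D K \<alpha> ^ (2 + D) = rate D K \<alpha> powr ?d"
    using powr_realpow[OF rate_pos[OF assms, of D], of "2 + D"] by simp
  also have "\<dots> = \<alpha> powr ((- 1 / 2) * ?d) * ?s powr (1 / (2 * ?d) * ?d)"
    using s by (simp add: rate_def powr_mult powr_powr)
  also have "1 / (2 * ?d) * ?d = 1 / 2" by (simp add: field_simps)
  also have "(- 1 / 2) * ?d = - (1 + real D / 2)" by (simp add: field_simps)
  finally show ?thesis using s by (simp add: powr_half_sqrt)
qed

text \<open>Bounded step sizes keep the rate above a multiple of \<open>h = K powr (- 1 / (2 (2 + D)))\<close>. Both
  \<open>1 / \<surd>K\<close> and the bias \<open>K powr (- a)\<close> are small at that scale: the former is at most \<open>h\<close>, and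
  the latter at most \<open>h\<^sup>D\<close> if \<open>a \<ge> D / (2 (2 + D))\<close>.\<close>

lemma rate_ge:
  assumes K: "2 \<le> K" and \<alpha>: "0 < \<alpha>" "\<alpha> \<le> \<alpha>m"
  shows "rate D 2 \<alpha>m * real K powr (- (1 / (2 * (2 + real D)))) \<le> rate D K \<alpha>"
proof -
  let ?p = "1 / (2 * (2 + real D))"
  have p: "0 < ?p" by simp
  have "rate D 2 \<alpha>m \<le> \<alpha>m powr (- 1 / 2) * ln 2 powr ?p"
    unfolding rate_def using p by (intro mult_left_mono powr_mono2) auto
  also have "\<dots> \<le> \<alpha> powr (- 1 / 2) * ln (real K) powr ?p"
    using p K \<alpha> by (intro mult_mono powr_mono2 powr_mono2') auto
  finally have "rate D 2 \<alpha>m * real K powr (- ?p) \<le> \<alpha> powr (- 1 / 2) * ln (real K) powr ?p * real K powr (- ?p)"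
    by (intro mult_right_mono) auto
  also have "\<dots> = rate D K \<alpha>"
    using K unfolding rate_def by (subst powr_divide) (auto simp: powr_minus_divide)
  finally show ?thesis .
qed

text \<open>The factor \<open>\<alpha> powr (- d / 2)\<close> comes from \<open>K \<beta>\<^sup>2 \<le> \<alpha> powr (- d / 2)\<close>, which bounds \<open>\<beta> \<le> K \<beta>\<^sup>2 + 1\<close> as well. All other terms are
  bounded by constants or by \<open>\<surd>(ln K)\<close>, which that factor and \<open>\<surd>(ln K)\<close> absorb since both are
  bounded away from 0.\<close>

lemma accumulated_error_le:
  fixes C J \<alpha> \<alpha>m \<beta> d :: real
  assumes K: "2 \<le> K" and \<alpha>: "0 < \<alpha>" "\<alpha> \<le> \<alpha>m" and \<beta>: "0 < \<beta>" "\<beta> \<le> 1 / (\<alpha> powr (d / 4) * sqrt (real K))"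
    and C: "0 < C" and J: "0 \<le> J" and d: "0 \<le> d"
  shows "(4 / (\<alpha> * real K)) * (J + real K * (C * (\<alpha>\<^sup>2 / real K + \<beta>\<^sup>2 + \<beta> / real K)
        + C * ((1 / sqrt (real K))\<^sup>2 + 1 / sqrt (real K) * sqrt (ln (real K) / real K))))
    \<le> 4 * ((J + C * (\<alpha>m\<^sup>2 + 2)) / (\<alpha>m powr (- d / 2) * sqrt (ln 2)) + 2 * C / sqrt (ln 2) + C / \<alpha>m powr (- d / 2))
      * (\<alpha> powr (- (1 + d / 2)) * sqrt (ln (real K) / real K)) * (1 / sqrt (real K))"
proof -
  let ?K = "real K" and ?z = "\<alpha> powr (- d / 2)" and ?zm = "\<alpha>m powr (- d / 2)"
  let ?q = "sqrt (ln (real K))" and ?q2 = "sqrt (ln 2)" and ?c0 = "J + C * (\<alpha>m\<^sup>2 + 2)"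
  have K0: "0 < ?K" "1 \<le> ?K" using K by auto
  have z: "0 < ?zm" "?zm \<le> ?z" using \<alpha> d by (auto intro: powr_mono2')
  have q: "0 < ?q2" "?q2 \<le> ?q" "0 \<le> ?q" using K by auto
  have c0: "0 \<le> ?c0" using J C by (intro add_nonneg_nonneg mult_nonneg_nonneg) auto
  have \<beta>2: "?K * \<beta>\<^sup>2 \<le> ?z"
  proof -
    have "\<beta>\<^sup>2 \<le> (1 / (\<alpha> powr (d / 4) * sqrt ?K))\<^sup>2" using \<beta> by (intro power_mono) auto
    also have "\<dots> = 1 / ((\<alpha> powr (d / 4))\<^sup>2 * ?K)" by (simp add: power_divide power_mult_distrib)
    also have "(\<alpha> powr (d / 4))\<^sup>2 = \<alpha> powr (d / 2)"
      by (simp add: power2_eq_square powr_add[symmetric])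
    also have "1 / (\<alpha> powr (d / 2) * ?K) = ?z / ?K" by (simp add: powr_minus_divide)
    finally show ?thesis using K0 by (simp add: pos_le_divide_eq mult.commute)
  qed
  have \<beta>1: "\<beta> \<le> ?z + 1"
  proof -
    have "0 \<le> (\<beta> - 1)\<^sup>2" by simp
    then have "\<beta> \<le> \<beta>\<^sup>2 + 1" using \<beta>(1) by (simp add: power2_eq_square algebra_simps)
    also have "\<beta>\<^sup>2 \<le> ?K * \<beta>\<^sup>2" using K0 mult_right_mono[of 1 ?K "\<beta>\<^sup>2"] by simp
    finally show ?thesis using \<beta>2 by linarith
  qed
  have root: "sqrt (ln ?K / ?K) * (1 / sqrt ?K) = ?q / ?K"
    using K0 by (simp add: real_sqrt_divide)
  have "?K * (C * (\<alpha>\<^sup>2 / ?K + \<beta>\<^sup>2 + \<beta> / ?K) + C * ((1 / sqrt ?K)\<^sup>2 + 1 / sqrt ?K * sqrt (ln ?K / ?K)))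
      = C * (\<alpha>\<^sup>2 + ?K * \<beta>\<^sup>2 + \<beta> + 1 + ?q)"
    unfolding mult.commute[of "1 / sqrt ?K"] root using K0 by (simp add: field_simps)
  also have "\<dots> \<le> C * (\<alpha>m\<^sup>2 + ?z + (?z + 1) + 1 + ?q)"
    using C \<beta>1 \<beta>2 \<alpha> by (intro mult_left_mono add_mono power_mono) auto
  finally have "J + ?K * (C * (\<alpha>\<^sup>2 / ?K + \<beta>\<^sup>2 + \<beta> / ?K) + C * ((1 / sqrt ?K)\<^sup>2 + 1 / sqrt ?K * sqrt (ln ?K / ?K)))
      \<le> ?c0 + 2 * C * ?z + C * ?q" by (simp add: algebra_simps)
  also have "\<dots> \<le> ?c0 / (?zm * ?q2) * (?z * ?q) + 2 * C / ?q2 * (?z * ?q) + C / ?zm * (?z * ?q)"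
  proof (intro add_mono)
    have "?zm * ?q2 \<le> ?z * ?q" using z q by (intro mult_mono) auto
    then have "?c0 * (?zm * ?q2) \<le> ?c0 * (?z * ?q)" using c0 by (intro mult_left_mono) auto
    then show "?c0 \<le> ?c0 / (?zm * ?q2) * (?z * ?q)" using z q by (simp add: field_simps)
    have "2 * C * ?z * ?q2 \<le> 2 * C * ?z * ?q" using C z q by (intro mult_left_mono) auto
    then show "2 * C * ?z \<le> 2 * C / ?q2 * (?z * ?q)" using q by (simp add: field_simps)
    have "C * ?q * ?zm \<le> C * ?q * ?z" using C z q by (intro mult_left_mono) auto
    then show "C * ?q \<le> C / ?zm * (?z * ?q)" using z by (simp add: field_simps)
  qed
  also have "\<dots> = (?c0 / (?zm * ?q2) + 2 * C / ?q2 + C / ?zm) * (?z * ?q)"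
    by (simp only: distrib_right)
  finally have "(4 / (\<alpha> * ?K)) * (J + ?K * (C * (\<alpha>\<^sup>2 / ?K + \<beta>\<^sup>2 + \<beta> / ?K) + C * ((1 / sqrt ?K)\<^sup>2 + 1 / sqrt ?K * sqrt (ln ?K / ?K))))
      \<le> (4 / (\<alpha> * ?K)) * ((?c0 / (?zm * ?q2) + 2 * C / ?q2 + C / ?zm) * (?z * ?q))"
    using \<alpha> K0 by (intro mult_left_mono) auto
  also have "\<dots> = 4 * (?c0 / (?zm * ?q2) + 2 * C / ?q2 + C / ?zm) * (?z / \<alpha>) * (?q / ?K)"
    by simp
  also have "?z / \<alpha> = \<alpha> powr (- d / 2 - 1)"
    using \<alpha> by (simp add: powr_diff)
  also have "- d / 2 - 1 = - (1 + d / 2)" by simp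
  finally show ?thesis by (simp only: root[symmetric] mult.assoc)
qed


context measure_problem
begin

text \<open>The scale is \<open>A\<close> times the rate, with \<open>A\<close> so large that the two smallness conditions of
  \<open>expectation_best_gap_le\<close> hold. If the rate exceeds 1, the trivial bound of the gap suffices; if
  not, the term \<open>E \<parallel>J'\<parallel>\<^sup>2 / \<delta>\<close> is of lower order.\<close>

theorem expectation_best_gap_rate:
  fixes c C CTV a \<alpha>m :: real
  assumes \<nu>star: "\<nu>star \<in> M_plus X" "\<And>\<mu>. \<mu> \<in> M_plus X \<Longrightarrow> obj \<nu>star \<le> obj \<mu>"
    and c: "0 < c" and C: "0 < C" and \<alpha>m: "0 < \<alpha>m"
    and a: "real DIM('a) / (2 * (2 + real DIM('a))) \<le> a"
  shows "\<exists>C'>0. \<forall>(K :: nat) \<alpha> \<beta> (M :: 'w measure) F Fp \<nu> \<nu>p.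
    stochastic_run X \<Phi> y \<kappa> cP CP c C CTV a \<alpha> \<beta> K M F Fp \<nu> \<nu>p \<and>
    \<alpha> \<le> \<alpha>m \<and> \<beta> \<le> 1 / (\<alpha> powr (real DIM('a) / 4) * sqrt (real K)) \<longrightarrow>
    prob_space.expectation M (best_gap X \<Phi> y \<kappa> \<nu>star \<nu> K) \<le> C' * rate DIM('a) K \<alpha>"
proof (cases "0 \<le> CTV")
  case False
  \<comment> \<open>A negative mass bound admits no run at all.\<close>
  then have "\<not> stochastic_run X \<Phi> y \<kappa> cP CP c C CTV a \<alpha> \<beta> K M F Fp \<nu> \<nu>p"
    for K \<alpha> \<beta> and M :: "'w measure" and F Fp \<nu> \<nu>p
    using stochastic_run.CTV_nonneg by blast
  then show ?thesis by (intro exI[of _ 1]) auto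
next
  case CTV: True
  let ?d = "DIM('a)" and ?m = "measure \<nu>star X" and ?J = "obj_bound CTV"
  obtain L0 where L0: "\<And>s t. s \<in> X \<Longrightarrow> t \<in> X \<Longrightarrow> norm (\<phi> s - \<phi> t) \<le> L0 * norm (s - t)"
    using feature_Lipschitz by blast
  define L where "L = max 1 L0"
  have L: "norm (\<phi> s - \<phi> t) \<le> L * norm (s - t)" if "s \<in> X" "t \<in> X" for s t
    using order_trans[OF L0[OF that] mult_right_mono[of L0 L "norm (s - t)"]] by (simp add: L_def)
  have L1: "1 \<le> L" by (simp add: L_def)
  obtain v where v: "0 < v"
    and vol: "\<And>t r. t \<in> X \<Longrightarrow> 0 < r \<Longrightarrow> r \<le> 1 \<Longrightarrow> v * r ^ ?d \<le> measure lborel (ball t r \<inter> X)"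
    using volume_ball_Int_ge[OF compact_X convex_X X_closure] by blast
  define \<Lambda> where "\<Lambda> = (mass_bound CTV C + CP) * L"
  define W where "W = 8 * (8 * \<Lambda>) ^ ?d / (c * v)"
  define g where "g = rate ?d 2 \<alpha>m"
  define A where "A = max (4 * C / g) (8 * \<Lambda> / g * max 1 (2 * C / (c * v)))"
  define B where "B = 4 * ((?J + C * (\<alpha>m\<^sup>2 + 2)) / (\<alpha>m powr (- real ?d / 2) * sqrt (ln 2))
    + 2 * C / sqrt (ln 2) + C / \<alpha>m powr (- real ?d / 2))"
  define C1 where "C1 = B / (2 * A) + 2 * B * W * ?m / A ^ (1 + ?d) + A * (CTV / 2 + ?m) + ?m * A / 4"
  have mb: "0 \<le> mass_bound CTV C" using CTV CP_pos \<kappa> C cP_pos by (simp add: mass_bound_def)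
  have \<Lambda>: "0 < \<Lambda>" using mb CP_pos L1 by (simp add: \<Lambda>_def)
  have g: "0 < g" unfolding g_def by (rule rate_pos) (use \<alpha>m in auto)
  have "0 < 4 * C / g" using C g by simp
  then have A: "0 < A" unfolding A_def by linarith
  have J: "0 \<le> ?J" using CTV \<kappa> by (simp add: obj_bound_def)
  have B: "0 \<le> B" unfolding B_def using J C \<alpha>m by (intro mult_nonneg_nonneg add_nonneg_nonneg divide_nonneg_nonneg) auto
  have W: "0 \<le> W" using \<Lambda> c v by (simp add: W_def)
  have C1: "0 \<le> C1" unfolding C1_def
    using B A W CTV by (intro add_nonneg_nonneg divide_nonneg_nonneg mult_nonneg_nonneg) auto
  have bound: "prob_space.expectation M (best_gap X \<Phi> y \<kappa> \<nu>star \<nu> K) \<le> (1 + C1 + ?J) * rate ?d K \<alpha>"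
    if run: "stochastic_run X \<Phi> y \<kappa> cP CP c C CTV a \<alpha> \<beta> K M F Fp \<nu> \<nu>p"
      and \<alpha>: "\<alpha> \<le> \<alpha>m" and \<beta>: "\<beta> \<le> 1 / (\<alpha> powr (real ?d / 4) * sqrt (real K))"
    for K \<alpha> \<beta> and M :: "'w measure" and F Fp \<nu> \<nu>p
  proof -
    interpret stochastic_run X \<Phi> y \<kappa> cP CP c C CTV a \<alpha> \<beta> K M F Fp \<nu> \<nu>p by (rule run)
    let ?E = "expectation (best_gap X \<Phi> y \<kappa> \<nu>star \<nu> K)"
    define \<eta> where "\<eta> = rate ?d K \<alpha>"
    have \<eta>: "0 < \<eta>" unfolding \<eta>_def by (rule rate_pos[OF K_ge \<alpha>_pos])
    show ?thesis
    proof (cases "\<eta> \<le> 1")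
      case False
      have "?E \<le> ?J * 1" using expectation_best_gap_le_obj_bound[OF \<nu>star] by simp
      also have "\<dots> \<le> (1 + C1 + ?J) * \<eta>" using False C1 J by (intro mult_mono) auto
      finally show ?thesis by (simp add: \<eta>_def)
    next
      case True
      define p where "p = 1 / (2 * (2 + real ?d))"
      define h where "h = real K powr (- p)"
      define e where "e = \<epsilon>"
      have h: "0 < h" using K_ge by (simp add: h_def)
      have e: "0 < e" "e \<le> 1" using \<epsilon>_pos \<epsilon>_le by (simp_all add: e_def)
      have gh: "g * h \<le> \<eta>"
        unfolding g_def h_def p_def \<eta>_def by (rule rate_ge[OF K_ge \<alpha>_pos \<alpha>])
      have eh: "e \<le> h"
      proof -
        have "e = real K powr (- (1 / 2))"
          by (simp add: e_def powr_minus_divide powr_half_sqrt)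
        also have "\<dots> \<le> h"
          unfolding h_def p_def using K_ge by (intro powr_mono) (auto simp: field_simps)
        finally show ?thesis .
      qed
      have Ag: "4 * C \<le> A * g" "8 * \<Lambda> * max 1 (2 * C / (c * v)) \<le> A * g"
        unfolding A_def using g by (simp_all add: max_mult_distrib_right)
      have \<delta>1: "4 * (C * e) \<le> A * \<eta>"
      proof -
        have "4 * (C * e) \<le> 4 * C * h" using C eh by simp
        also have "\<dots> \<le> A * g * h" using Ag(1) h by (intro mult_right_mono) auto
        also have "\<dots> \<le> A * \<eta>" using gh A by (simp add: mult.assoc)
        finally show ?thesis .
      qed
      have bias: "2 * (C * real K powr (- a)) \<le> c * (v * (A * \<eta> / (8 * \<Lambda>)) ^ ?d)"
      proof -
        let ?u = "max 1 (2 * C / (c * v))"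
        have "real K powr (- a) \<le> real K powr (- p * real ?d)"
          using K_ge a by (intro powr_mono) (auto simp: p_def)
        also have "\<dots> = h ^ ?d"
          using K_ge powr_powr[of "real K" "- p" "real ?d"] powr_realpow[OF h, of ?d]
          by (simp add: h_def)
        finally have Ka: "real K powr (- a) \<le> h ^ ?d" .
        have "8 * \<Lambda> * (?u * h) \<le> A * g * h"
          using mult_right_mono[OF Ag(2), of h] h by (simp add: mult.assoc)
        also have "\<dots> \<le> A * \<eta>" using gh A by (simp add: mult.assoc)
        finally have "?u * h \<le> A * \<eta> / (8 * \<Lambda>)" using \<Lambda> by (simp add: pos_le_divide_eq mult.commute)
        then have "(?u * h) ^ ?d \<le> (A * \<eta> / (8 * \<Lambda>)) ^ ?d" using h by (intro power_mono) auto
        moreover have "?u * h ^ ?d \<le> (?u * h) ^ ?d"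
          unfolding power_mult_distrib using h self_le_power[of ?u ?d] by (intro mult_right_mono) auto
        moreover have "2 * C / (c * v) * real K powr (- a) \<le> ?u * h ^ ?d"
          using Ka by (intro mult_mono) auto
        ultimately have "2 * C / (c * v) * real K powr (- a) \<le> (A * \<eta> / (8 * \<Lambda>)) ^ ?d" by linarith
        then have "c * v * (2 * C / (c * v) * real K powr (- a)) \<le> c * v * (A * \<eta> / (8 * \<Lambda>)) ^ ?d"
          using c v by (intro mult_left_mono) auto
        then show ?thesis using c v by (simp add: mult.assoc)
      qed
      let ?S = "(4 / (\<alpha> * real K)) * (?J + real K * (noise + drift))"
      let ?R = "1 / (2 * (A * \<eta>)) + 2 * W * ?m / (e * (A * \<eta>) ^ (1 + ?d))"
      have "?S \<le> B * \<eta> ^ (2 + ?d) * e"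
        unfolding B_def \<eta>_def e_def rate_power[OF K_ge \<alpha>_pos] noise_def drift_def
        by (rule accumulated_error_le[OF K_ge \<alpha>_pos \<alpha> \<beta>_pos \<beta> C J]) simp
      moreover have "0 \<le> ?R" using A \<eta> e W by (intro add_nonneg_nonneg divide_nonneg_nonneg mult_nonneg_nonneg) auto
      ultimately have "?S * ?R \<le> (B * \<eta> ^ (2 + ?d) * e) * ?R" by (rule mult_right_mono)
      also have "\<dots> = B / (2 * A) * (\<eta> ^ (1 + ?d) * e) + 2 * B * W * ?m / A ^ (1 + ?d) * \<eta>"
        using A \<eta> e by (simp add: distrib_left power_mult_distrib mult_ac)
      also have "\<dots> \<le> B / (2 * A) * \<eta> + 2 * B * W * ?m / A ^ (1 + ?d) * \<eta>"
      proof (intro add_right_mono mult_left_mono)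
        \<comment> \<open>The left-hand side is a higher power of \<open>\<eta>\<close>, hence the separate treatment of \<open>\<eta> > 1\<close>.\<close>
        have "\<eta> ^ (1 + ?d) \<le> \<eta> ^ 1" using True \<eta> by (intro power_decreasing) auto
        then have "\<eta> ^ (1 + ?d) * e \<le> \<eta> ^ 1 * 1" using e \<eta> by (intro mult_mono) auto
        then show "\<eta> ^ (1 + ?d) * e \<le> \<eta>" by simp
      qed (use A B in simp)
      finally have SR: "?S * ?R \<le> B / (2 * A) * \<eta> + 2 * B * W * ?m / A ^ (1 + ?d) * \<eta>" .
      have me: "?m * (C * e) \<le> ?m * A / 4 * \<eta>"
        using mult_left_mono[OF \<delta>1, of "?m"] by simp
      have "?E \<le> ?S * ?R + A * \<eta> * (CTV / 2 + ?m) + ?m * (C * e)"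
        using expectation_best_gap_le[OF \<nu>star L L1 v vol \<Lambda>_def, of "A * \<eta>"] A \<eta> \<delta>1 bias
        unfolding e_def level_const_def W_def by simp
      also have "\<dots> \<le> C1 * \<eta>"
        using SR me by (simp only: C1_def distrib_right) (simp add: mult_ac)
      also have "\<dots> \<le> (1 + C1 + ?J) * \<eta>" using J \<eta> by (intro mult_right_mono) auto
      finally show ?thesis by (simp add: \<eta>_def)
    qed
  qed
  show ?thesis
    by (intro exI[of _ "1 + C1 + ?J"] conjI allI impI) (use C1 J bound in auto)
qed

end

theorem corollary3p1:
  fixes X :: "'a::euclidean_space set"
    and \<Phi> :: "('a set \<Rightarrow> real) \<Rightarrow> 'h::{real_inner, banach, second_countable_topology}"
    and y :: 'h
    and \<kappa> cP CP c C CTV a Einf G H :: real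
    and Q :: "'z measure"
    and Jh :: "'a measure \<Rightarrow> 'a \<Rightarrow> 'z \<Rightarrow> real"
    and Dh :: "'a measure \<Rightarrow> 'a \<Rightarrow> 'z \<Rightarrow> 'a"
    and \<nu>star :: "'a measure"
  defines "d \<equiv> real DIM('a)"
  assumes "compact X" and "convex X" and "X = closure (interior X)"
    and "forward_operator X \<Phi>"
    and "0 < \<kappa>"
    and "problem_assumption X \<Phi> y cP CP"
    and "stochastic_gradients X \<Phi> y \<kappa> Q Jh Dh Einf G H"
    and "0 < c" and "0 < C"
    and "a \<ge> d / (2 * (2 + d))"
    and "is_arg_min (J X \<Phi> y \<kappa>) (\<lambda>\<nu>. \<nu> \<in> M_plus X) \<nu>star"
  shows
    "(\<exists>C' > 0. \<forall>(K::nat) (\<alpha>::real) (\<beta>::real) (M :: 'w measure) F Fp \<nu> \<nu>p.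
        K \<ge> 2 \<and> 0 < \<alpha> \<and> \<alpha> \<le> 1 / Einf * sqrt (8 * ln 8) \<and>
        0 < \<beta> \<and> \<beta> \<le> 1 / (\<alpha> powr (d / 4) * sqrt (real K)) \<and>
        admissible_sequence X \<Phi> y \<kappa> c C CTV a \<alpha> \<beta> (\<lambda>_. 1 / sqrt (real K)) (\<lambda>_. K) M F Fp \<nu> \<nu>p
        \<longrightarrow> (let N = oracle_calls K (\<lambda>_. K) in
              N = K * K \<and>
              prob_space.expectation M (best_gap X \<Phi> y \<kappa> \<nu>star \<nu> K)
              \<le> C' * \<alpha> powr (- 1 / 2) * (ln (real N) / sqrt (real N)) powr (1 / (2 * (2 + d)))))
     \<and>
     (\<forall>(\<alpha>::real) (\<beta> :: nat \<Rightarrow> real) (M :: nat \<Rightarrow> 'w measure) F Fp \<nu> \<nu>p.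
        0 < \<alpha> \<and> \<alpha> \<le> 1 / Einf * sqrt (8 * ln 8) \<and>
        (\<forall>K\<ge>2. 0 < \<beta> K \<and> \<beta> K \<le> 1 / (\<alpha> powr (d / 4) * sqrt (real K)) \<and>
           admissible_sequence X \<Phi> y \<kappa> c C CTV a \<alpha> (\<beta> K) (\<lambda>_. 1 / sqrt (real K)) (\<lambda>_. K)
             (M K) (F K) (Fp K) (\<nu> K) (\<nu>p K))
        \<longrightarrow> (\<lambda>K. prob_space.expectation (M K) (best_gap X \<Phi> y \<kappa> \<nu>star (\<nu> K) K))
            \<in> O(\<lambda>K. real (oracle_calls K (\<lambda>_. K)) powr (- 1 / (4 * (2 + d)))
                    * ln (real (oracle_calls K (\<lambda>_. K))) powr (1 / (2 * (2 + d)))))"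
proof -
  interpret measure_problem X \<Phi> y \<kappa> cP CP
    using assms by unfold_locales
  have \<nu>star: "\<nu>star \<in> M_plus X" "\<And>\<mu>. \<mu> \<in> M_plus X \<Longrightarrow> obj \<nu>star \<le> obj \<mu>"
    using assms(12) by (auto simp: is_arg_min_def not_less)
  let ?\<alpha>m = "1 / Einf * sqrt (8 * ln 8)"
  have \<alpha>m: "0 < ?\<alpha>m"
    using assms(8) by (simp add: stochastic_gradients_def)
  have run: "stochastic_run X \<Phi> y \<kappa> cP CP c C CTV a \<alpha> \<beta> K M F Fp \<nu> \<nu>p"
    if "2 \<le> K" "0 < \<alpha>" "0 < \<beta>"
      "admissible_sequence X \<Phi> y \<kappa> c C CTV a \<alpha> \<beta> (\<lambda>_. 1 / sqrt (real K)) (\<lambda>_. K) M F Fp \<nu> \<nu>p"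
    for K \<alpha> \<beta> and M :: "'w measure" and F Fp \<nu> \<nu>p
    using that assms by unfold_locales
  obtain C' where C': "0 < C'"
    and rate: "\<And>K \<alpha> \<beta> (M :: 'w measure) F Fp \<nu> \<nu>p.
      stochastic_run X \<Phi> y \<kappa> cP CP c C CTV a \<alpha> \<beta> K M F Fp \<nu> \<nu>p \<Longrightarrow> \<alpha> \<le> ?\<alpha>m \<Longrightarrow>
      \<beta> \<le> 1 / (\<alpha> powr (d / 4) * sqrt (real K)) \<Longrightarrow>
      prob_space.expectation M (best_gap X \<Phi> y \<kappa> \<nu>star \<nu> K) \<le> C' * rate DIM('a) K \<alpha>"
    using expectation_best_gap_rate[OF \<nu>star \<open>0 < c\<close> \<open>0 < C\<close> \<alpha>m, of a CTV] assms(11)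
    unfolding d_def by blast
  let ?p = "1 / (2 * (2 + d))"
  have calls: "oracle_calls K (\<lambda>_. K) = K * K" for K
    by (simp add: oracle_calls_def)
  have bound: "prob_space.expectation M (best_gap X \<Phi> y \<kappa> \<nu>star \<nu> K)
      \<le> C' * \<alpha> powr (- 1 / 2) * (ln (real (K * K)) / sqrt (real (K * K))) powr ?p"
    if K: "2 \<le> K" and \<alpha>: "0 < \<alpha>" "\<alpha> \<le> ?\<alpha>m" and \<beta>: "0 < \<beta>" "\<beta> \<le> 1 / (\<alpha> powr (d / 4) * sqrt (real K))"
      and adm: "admissible_sequence X \<Phi> y \<kappa> c C CTV a \<alpha> \<beta> (\<lambda>_. 1 / sqrt (real K)) (\<lambda>_. K) M F Fp \<nu> \<nu>p"
    for K \<alpha> \<beta> and M :: "'w measure" and F Fp \<nu> \<nu>p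
  proof -
    have "prob_space.expectation M (best_gap X \<Phi> y \<kappa> \<nu>star \<nu> K) \<le> C' * rate DIM('a) K \<alpha>"
      by (rule rate[OF run[OF K \<alpha>(1) \<beta>(1) adm] \<alpha>(2) \<beta>(2)])
    also have "\<dots> = C' * \<alpha> powr (- 1 / 2) * (ln (real K) / real K) powr ?p"
      by (simp add: rate_def d_def)
    also have "\<dots> \<le> C' * \<alpha> powr (- 1 / 2) * (ln (real (K * K)) / sqrt (real (K * K))) powr ?p"
      using K C' by (intro mult_left_mono powr_mono2) (auto simp: ln_mult d_def intro!: divide_right_mono)
    finally show ?thesis .
  qed
  show ?thesis
  proof (intro conjI)
    show "\<exists>C' > 0. \<forall>(K::nat) (\<alpha>::real) (\<beta>::real) (M :: 'w measure) F Fp \<nu> \<nu>p.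
        K \<ge> 2 \<and> 0 < \<alpha> \<and> \<alpha> \<le> 1 / Einf * sqrt (8 * ln 8) \<and>
        0 < \<beta> \<and> \<beta> \<le> 1 / (\<alpha> powr (d / 4) * sqrt (real K)) \<and>
        admissible_sequence X \<Phi> y \<kappa> c C CTV a \<alpha> \<beta> (\<lambda>_. 1 / sqrt (real K)) (\<lambda>_. K) M F Fp \<nu> \<nu>p
        \<longrightarrow> (let N = oracle_calls K (\<lambda>_. K) in
              N = K * K \<and>
              prob_space.expectation M (best_gap X \<Phi> y \<kappa> \<nu>star \<nu> K)
              \<le> C' * \<alpha> powr (- 1 / 2) * (ln (real N) / sqrt (real N)) powr (1 / (2 * (2 + d))))"
      unfolding calls Let_def using bound C' by (intro exI[of _ C'] conjI allI impI) blast+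
  next
    show "\<forall>(\<alpha>::real) (\<beta> :: nat \<Rightarrow> real) (M :: nat \<Rightarrow> 'w measure) F Fp \<nu> \<nu>p.
        0 < \<alpha> \<and> \<alpha> \<le> 1 / Einf * sqrt (8 * ln 8) \<and>
        (\<forall>K\<ge>2. 0 < \<beta> K \<and> \<beta> K \<le> 1 / (\<alpha> powr (d / 4) * sqrt (real K)) \<and>
           admissible_sequence X \<Phi> y \<kappa> c C CTV a \<alpha> (\<beta> K) (\<lambda>_. 1 / sqrt (real K)) (\<lambda>_. K)
             (M K) (F K) (Fp K) (\<nu> K) (\<nu>p K))
        \<longrightarrow> (\<lambda>K. prob_space.expectation (M K) (best_gap X \<Phi> y \<kappa> \<nu>star (\<nu> K) K))
            \<in> O(\<lambda>K. real (oracle_calls K (\<lambda>_. K)) powr (- 1 / (4 * (2 + d)))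
                    * ln (real (oracle_calls K (\<lambda>_. K))) powr (1 / (2 * (2 + d))))"
    proof (intro allI impI, elim conjE)
      fix \<alpha> :: real and \<beta> :: "nat \<Rightarrow> real" and M :: "nat \<Rightarrow> 'w measure" and F Fp \<nu> \<nu>p
      assume \<alpha>: "0 < \<alpha>" "\<alpha> \<le> ?\<alpha>m"
        and all: "\<forall>K\<ge>2. 0 < \<beta> K \<and> \<beta> K \<le> 1 / (\<alpha> powr (d / 4) * sqrt (real K)) \<and>
           admissible_sequence X \<Phi> y \<kappa> c C CTV a \<alpha> (\<beta> K) (\<lambda>_. 1 / sqrt (real K)) (\<lambda>_. K)
             (M K) (F K) (Fp K) (\<nu> K) (\<nu>p K)"
      let ?E = "\<lambda>K. prob_space.expectation (M K) (best_gap X \<Phi> y \<kappa> \<nu>star (\<nu> K) K)"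
      let ?r = "\<lambda>K. real (oracle_calls K (\<lambda>_. K)) powr (- 1 / (4 * (2 + d)))
                    * ln (real (oracle_calls K (\<lambda>_. K))) powr ?p"
      have "norm (?E K) \<le> (C' * \<alpha> powr (- 1 / 2)) * norm (?r K)" if K: "2 \<le> K" for K
      proof -
        have \<beta>: "0 < \<beta> K" "\<beta> K \<le> 1 / (\<alpha> powr (d / 4) * sqrt (real K))"
          and adm: "admissible_sequence X \<Phi> y \<kappa> c C CTV a \<alpha> (\<beta> K) (\<lambda>_. 1 / sqrt (real K)) (\<lambda>_. K)
             (M K) (F K) (Fp K) (\<nu> K) (\<nu>p K)"
          using all K by blast+
        have "0 \<le> ?E K"
          using stochastic_run.best_gap_nonneg[OF run[OF K \<alpha>(1) \<beta>(1) adm] \<nu>star(2)]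
          by (intro integral_nonneg_AE AE_I2)
        moreover have "(ln (real (K * K)) / sqrt (real (K * K))) powr ?p = ?r K"
        proof -
          have N: "0 < real (K * K)" using K by simp
          then have "sqrt (real (K * K)) powr ?p = real (K * K) powr (1 / (4 * (2 + d)))"
            by (simp only: powr_half_sqrt[symmetric] powr_powr) (simp add: field_simps)
          then show ?thesis
            using N K unfolding calls by (subst powr_divide) (simp_all add: powr_minus_divide)
        qed
        ultimately show ?thesis using bound[OF K \<alpha> \<beta> adm] by simp
      qed
      then show "?E \<in> O(?r)"
        by (intro bigoI[of _ "C' * \<alpha> powr (- 1 / 2)"] eventually_sequentiallyI[of 2])
    qed
  qed
qed

end
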